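(* Let $T_n$ be a goodness-of-fit statistic for testing $H_0:F\in\mathcal{F}_0$ against $H_1:F\in\mathcal{F}_1$, let $F_0$ denote the null distribution, let $d$ be a distance on distributions, and let $\Pi_1$ be the prior on $\mathcal{F}_1$. Let $\rho>0$ and $\kappa>0$ be constants. Suppose: (i) (Sub-Gaussian null tail) $\mathbb{P}_{F_0}(\sqrt{n}\,T_n>t)\asymp \exp\{-2\rho t^2\}$ for $t\to\infty$; (ii) (Local detectability) alternatives at distance $\varepsilon$ from $\mathcal{F}_0$ are detected once $\varepsilon\gg t/\sqrt{n}$, i.e. if $d(F,\mathcal{F}_0)=\varepsilon$ with $\varepsilon\sqrt{n}/t\to\infty$, then $\mathbb{P}_F(\sqrt{n}\,T_n>t)\to1$; (iii) (Polynomial prior mass) $\Pi_1(\{F: d(F,\mathcal{F}_0)\le\varepsilon\})\asymp\varepsilon^{\kappa}$ for small $\varepsilon>0$. Set $t_n=\sqrt{a\log n}$. Then the Bayes risk of the threshold test $\delta_{n,t_n}=\mathbf{1}\{\sqrt{n}\,T_n>t_n\}$ satisfies $$B_n(t_n)\asymp n^{-2\rho a}+\left(\frac{a\log n}{n}\right)^{\kappa/2}.$$ Minimising over $a$ yields $a^{*}=\kappa/(4\rho)$, whence the Bayes-optimal threshold is $t_n^{*}=\sqrt{\kappa\log n/(4\rho)}+O(\sqrt{\log\log n})$, the Type I error decays polynomially as $\alpha_n^{*}\asymp n^{-\kappa/2}$, and the optimal Bayes risk is $B_n^{*}\asymp(\log n/n)^{\kappa/2}$. By contrast, fixed-$\alpha$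 calibration ($a=0$) leaves $B_n$ bounded away from zero, and large-deviation calibration ($a\propto n$) forces the Type II error term to dominate the Bayes risk.
   Context: $X_1,\dots,X_n$ are i.i.d. with distribution $F$ on a measurable space. $\mathcal{F}_0,\mathcal{F}_1$ are disjoint classes of distributions; $d(F,\mathcal{F}_0)$ denotes the distance from $F$ to $\mathcal{F}_0$. Prior probabilities of the hypotheses are $\pi_0,\pi_1>0$ with $\pi_0+\pi_1=1$; $\Pi_0$ and $\Pi_1$ are probability measures on $\mathcal{F}_0$ and $\mathcal{F}_1$; $L_0,L_1>0$ are the losses for Type I and Type II errors. The Bayes risk of a test $\delta_n$ (with $\delta_n(x^n)\in[0,1]$ the probability of rejecting $H_0$) is $$B_n(\delta_n)=\pi_0L_0\,\mathbb{E}_{F\sim\Pi_0}\big[\mathbb{E}_F[\delta_n(X^n)]\big]+\pi_1L_1\,\mathbb{E}_{F\sim\Pi_1}\big[\mathbb{E}_F[1-\delta_n(X^n)]\big],$$ and $B_n(t)$ denotes the Bayes risk of the test $\mathbf{1}\{\sqrt{n}\,T_n>t\}$. Its Type I error is $\alpha_n=\mathbb{P}_{F_0}(\sqrt{n}\,T_n>t_n)$; the Type II error term is $\pi_1L_1\,\mathbb{E}_{F\sim\Pi_1}[\mathbb{P}_F(\sqrt{n}\,T_n\le t_n)]$. The notation $f\asymp g$ means $c\,g\le f\le C\,g$ for positive constants $c,C$ independent of $n$. Starred quantities denote values at the Bayes-optimal threshold.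
   Formalization: Added to (ii): miss probability ≤ C(t/(ε√n))^γ with γ>κ, and bounded below for ε ≤ kt/√n; (i) uniform over the null class. The Bayes-optimal threshold is the minimiser of the displayed rate; α_n* ≍ n^{-κ/2} holds at a=κ/(4ρ), only the exponent at the minimiser. *)

theory Defs
  imports "HOL-Probability.Probability" "HOL-Library.Landau_Symbols"
begin

text \<open>
  Distributions are probability measures on a measurable space \<open>M\<close>, i.e. elements of
  \<open>space (prob_algebra M)\<close>. A statistic is a family \<open>T n\<close> of functions of the sample
  \<open>(x 0, \<dots>, x (n - 1))\<close>; tests take values in \<open>[0,1]\<close> (probability of rejection).
\<close>

definition iid :: "nat \<Rightarrow> 'a measure \<Rightarrow> (nat \<Rightarrow> 'a) measure" where
  "iid n F = Pi\<^sub>M {..<n} (\<lambda>_. F)"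

definition set_distance :: "('a measure \<Rightarrow> 'a measure \<Rightarrow> real) \<Rightarrow> 'a measure set \<Rightarrow> 'a measure \<Rightarrow> real" where
  "set_distance d \<F> F = (INF G\<in>\<F>. d F G)"

definition threshold_test :: "(nat \<Rightarrow> (nat \<Rightarrow> 'a) \<Rightarrow> real) \<Rightarrow> nat \<Rightarrow> real \<Rightarrow> (nat \<Rightarrow> 'a) \<Rightarrow> real" where
  "threshold_test T n t = indicator {x. sqrt (real n) * T n x > t}"

definition reject_prob :: "(nat \<Rightarrow> (nat \<Rightarrow> 'a) \<Rightarrow> real) \<Rightarrow> nat \<Rightarrow> 'a measure \<Rightarrow> real \<Rightarrow> real" where
  "reject_prob T n F t = measure (iid n F) {x \<in> space (iid n F). sqrt (real n) * T n x > t}"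

definition accept_prob :: "(nat \<Rightarrow> (nat \<Rightarrow> 'a) \<Rightarrow> real) \<Rightarrow> nat \<Rightarrow> 'a measure \<Rightarrow> real \<Rightarrow> real" where
  "accept_prob T n F t = measure (iid n F) {x \<in> space (iid n F). sqrt (real n) * T n x \<le> t}"

definition type_I_term :: "real \<Rightarrow> real \<Rightarrow> 'a measure measure \<Rightarrow> nat \<Rightarrow> ((nat \<Rightarrow> 'a) \<Rightarrow> real) \<Rightarrow> real" where
  "type_I_term \<pi>0 L0 \<Pi>0 n \<delta> = \<pi>0 * L0 * (\<integral>F. (\<integral>x. \<delta> x \<partial>iid n F) \<partial>\<Pi>0)"

definition type_II_term :: "real \<Rightarrow> real \<Rightarrow> 'a measure measure \<Rightarrow> nat \<Rightarrow> ((nat \<Rightarrow> 'a) \<Rightarrow> real) \<Rightarrow> real" where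
  "type_II_term \<pi>1 L1 \<Pi>1 n \<delta> = \<pi>1 * L1 * (\<integral>F. (\<integral>x. 1 - \<delta> x \<partial>iid n F) \<partial>\<Pi>1)"

definition bayes_risk ::
  "real \<Rightarrow> real \<Rightarrow> 'a measure measure \<Rightarrow> real \<Rightarrow> real \<Rightarrow> 'a measure measure \<Rightarrow>
    nat \<Rightarrow> ((nat \<Rightarrow> 'a) \<Rightarrow> real) \<Rightarrow> real" where
  "bayes_risk \<pi>0 L0 \<Pi>0 \<pi>1 L1 \<Pi>1 n \<delta> = type_I_term \<pi>0 L0 \<Pi>0 n \<delta> + type_II_term \<pi>1 L1 \<Pi>1 n \<delta>"

text \<open>
  A prior on a class \<open>\<F>\<close> may use any \<open>\<sigma>\<close>-algebra on \<open>\<F>\<close> for which all evaluations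
  \<open>F \<mapsto> F(A)\<close> are measurable.
\<close>

definition prior_on :: "'a measure \<Rightarrow> 'a measure set \<Rightarrow> 'a measure measure \<Rightarrow> bool" where
  "prior_on M \<F> P \<longleftrightarrow> prob_space P \<and> space P = \<F> \<and> (\<lambda>F. F) \<in> P \<rightarrow>\<^sub>M prob_algebra M"

text \<open>
  The null tail depends on \<open>n\<close> as well as on \<open>t\<close>, and for a bounded statistic the lower bound
  fails for \<open>t\<close> of order \<open>sqrt n\<close>. It is required only in the windows \<open>t\<^sub>0 \<le> t \<le> A * sqrt (ln n)\<close>,
  for \<open>n\<close> large, uniformly over the null class.
\<close>

definition subgaussian_null_tail ::
  "(nat \<Rightarrow> (nat \<Rightarrow> 'a) \<Rightarrow> real) \<Rightarrow> 'a measure set \<Rightarrow> real \<Rightarrow> bool" where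
  "subgaussian_null_tail T \<F>0 \<rho> \<longleftrightarrow>
    (\<forall>A>0. \<exists>c>0. \<exists>C>0. \<exists>t0>0. \<forall>\<^sub>F n in sequentially.
      \<forall>F\<in>\<F>0. \<forall>t\<in>{t0..A * sqrt (ln (real n))}.
        c * exp (- 2 * \<rho> * t\<^sup>2) \<le> reject_prob T n F t \<and>
        reject_prob T n F t \<le> C * exp (- 2 * \<rho> * t\<^sup>2))"

definition local_detectability ::
  "(nat \<Rightarrow> (nat \<Rightarrow> 'a) \<Rightarrow> real) \<Rightarrow> ('a measure \<Rightarrow> 'a measure \<Rightarrow> real) \<Rightarrow>
    'a measure set \<Rightarrow> 'a measure set \<Rightarrow> bool" where
  "local_detectability T d \<F>0 \<F>1 \<longleftrightarrow>
    (\<forall>F t. (\<forall>n. F n \<in> \<F>1) \<longrightarrow> filterlim t at_top sequentially \<longrightarrow>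
      filterlim (\<lambda>n. set_distance d \<F>0 (F n) * sqrt (real n) / t n) at_top sequentially \<longrightarrow>
      (\<lambda>n. reject_prob T n (F n) (t n)) \<longlonglongrightarrow> 1)"

definition polynomial_prior_mass ::
  "('a measure \<Rightarrow> 'a measure \<Rightarrow> real) \<Rightarrow> 'a measure set \<Rightarrow> 'a measure measure \<Rightarrow> real \<Rightarrow> bool" where
  "polynomial_prior_mass d \<F>0 \<Pi>1 \<kappa> \<longleftrightarrow>
    (\<exists>c>0. \<exists>C>0. \<exists>\<epsilon>0>0. \<forall>\<epsilon>\<in>{0<..\<epsilon>0}.
      c * \<epsilon> powr \<kappa> \<le> measure \<Pi>1 {F \<in> space \<Pi>1. set_distance d \<F>0 F \<le> \<epsilon>} \<and>
      measure \<Pi>1 {F \<in> space \<Pi>1. set_distance d \<F>0 F \<le> \<epsilon>} \<le> C * \<epsilon> powr \<kappa>)"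

text \<open>
  Local detectability says neither how fast the power tends to 1 nor that alternatives closer than
  \<open>t / sqrt n\<close> are missed. Without the first, alternatives far from the null may dominate the
  Type II error; without the second, the Type II error may vanish. The next two conditions state
  these two properties, again in the windows \<open>t\<^sub>0 \<le> t \<le> A * sqrt (ln n)\<close>. The rate is a power of
  \<open>t / (\<epsilon> * sqrt n)\<close> with an exponent larger than the exponent \<open>\<kappa>\<close> of the prior mass.
\<close>

definition detection_rate ::
  "(nat \<Rightarrow> (nat \<Rightarrow> 'a) \<Rightarrow> real) \<Rightarrow> ('a measure \<Rightarrow> 'a measure \<Rightarrow> real) \<Rightarrow>
    'a measure set \<Rightarrow> 'a measure set \<Rightarrow> real \<Rightarrow> bool" where
  "detection_rate T d \<F>0 \<F>1 \<kappa> \<longleftrightarrow>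
    (\<forall>A>0. \<exists>\<gamma>>\<kappa>. \<exists>C>0. \<exists>t0>0. \<forall>\<^sub>F n in sequentially.
      \<forall>F\<in>\<F>1. \<forall>t\<in>{t0..A * sqrt (ln (real n))}.
        t < set_distance d \<F>0 F * sqrt (real n) \<longrightarrow>
        accept_prob T n F t \<le> C * (t / (set_distance d \<F>0 F * sqrt (real n))) powr \<gamma>)"

definition undetected_below_scale ::
  "(nat \<Rightarrow> (nat \<Rightarrow> 'a) \<Rightarrow> real) \<Rightarrow> ('a measure \<Rightarrow> 'a measure \<Rightarrow> real) \<Rightarrow>
    'a measure set \<Rightarrow> 'a measure set \<Rightarrow> bool" where
  "undetected_below_scale T d \<F>0 \<F>1 \<longleftrightarrow>
    (\<forall>A>0. \<exists>k>0. \<exists>c>0. \<exists>t0>0. \<forall>\<^sub>F n in sequentially.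
      \<forall>F\<in>\<F>1. \<forall>t\<in>{t0..A * sqrt (ln (real n))}.
        set_distance d \<F>0 F * sqrt (real n) \<le> k * t \<longrightarrow> c \<le> accept_prob T n F t)"

definition log_threshold :: "real \<Rightarrow> nat \<Rightarrow> real" where
  "log_threshold a n = sqrt (a * ln (real n))"

text \<open>
  The minimiser of the rate below over \<open>a\<close> depends on \<open>n\<close> and tends to \<open>\<kappa> / (4 * \<rho>)\<close>. At the minimiser
  itself the first term has order \<open>n powr (- \<kappa> / 2) * ln n powr (\<kappa> / 2 - 1)\<close>; it has exact order
  \<open>n powr (- \<kappa> / 2)\<close> at the limit \<open>a = \<kappa> / (4 * \<rho>)\<close>.
\<close>

definition risk_rate :: "real \<Rightarrow> real \<Rightarrow> nat \<Rightarrow> real \<Rightarrow> real" where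
  "risk_rate \<rho> \<kappa> n a = real n powr (- 2 * \<rho> * a) + (a * ln (real n) / real n) powr (\<kappa> / 2)"

end

theory Submission
  imports Defs "HOL-Real_Asymp.Real_Asymp"
begin

text \<open>
  The Bayes risk of a threshold test is a Type I term, decreasing in the threshold \<open>t\<close>, plus a Type II
  term, increasing in \<open>t\<close>. The proof determines the orders of both terms, uniformly over thresholds up to a
  multiple of \<open>sqrt (ln n)\<close>, and then studies their sum.

  The Type I term has order \<open>exp (- 2 * \<rho> * t\<^sup>2)\<close>, since the null tail is uniform over the null class
  (\<open>window_order_type_I_term\<close>). For the Type II term, let \<open>e = t / sqrt n\<close>. Alternatives at distance
  at most a multiple of \<open>e\<close> are missed with probability bounded below, and have prior mass of order
  \<open>e powr \<kappa>\<close>. The miss probability of an alternative at distance \<open>\<epsilon> > e\<close> is at most a multiple of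
  \<open>(e / \<epsilon>) powr \<gamma>\<close> with \<open>\<gamma> > \<kappa>\<close>; this decay beats the growth \<open>\<epsilon> powr \<kappa>\<close> of the prior mass, so that the sum over dyadic
  shells is dominated by the innermost one (\<open>expectation_le_of_small_ball\<close>). Hence the Type II term has
  order \<open>(t / sqrt n) powr \<kappa>\<close> (\<open>window_order_type_II_term\<close>).

  At \<open>t = sqrt (a * ln n)\<close> the two orders add up to \<open>risk_rate\<close>. Its terms balance, up to logarithms,
  at \<open>a = \<kappa> / (4 * \<rho>)\<close>, and comparison of a minimiser with this point and with a slightly larger one
  places it within \<open>O(ln (ln n) / ln n)\<close> (\<open>arg_min_risk_rate_asymp\<close>). This yields the expansion of
  the threshold and the polynomial decay of the Type I error.

  The statements about all thresholds, fixed levels and very large thresholds follow by monotonicity: a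
  threshold outside the windows is compared with one inside (\<open>INF_risk\<close>, \<open>risk_bounded_below\<close>,
  \<open>large_threshold_smallo\<close>).
\<close>

section \<open>Error probabilities as functions of the drawn distribution\<close>

text \<open>
  On boxes the product measure is a product of evaluations \<open>F \<mapsto> F(X\<^sub>i)\<close>; boxes generate the product \<open>\<sigma>\<close>-algebra and are closed under intersection. This
  is what makes the averages of error probabilities over a prior meaningful Bochner integrals:
  without measurability in \<open>F\<close> they would take the default value 0.
\<close>

lemma measurable_iid: "iid n \<in> prob_algebra M \<rightarrow>\<^sub>M prob_algebra (Pi\<^sub>M {..<n} (\<lambda>_. M))"
proof (rule measurable_prob_algebra_generated[OF sets_PiM Int_stable_prod_algebra prod_algebra_sets_into_space])
  fix F assume F: "F \<in> space (prob_algebra M)"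
  show "prob_space (iid n F)"
    using F unfolding iid_def by (intro prob_space_PiM) (auto simp: space_prob_algebra)
  show "sets (iid n F) = sets (Pi\<^sub>M {..<n} (\<lambda>_. M))"
    using F unfolding iid_def by (intro sets_PiM_cong) (auto simp: space_prob_algebra)
next
  fix A assume "A \<in> prod_algebra {..<n} (\<lambda>_. M)"
  then obtain X where X: "A = (\<Pi>\<^sub>E i\<in>{..<n}. X i)" "\<And>i. i < n \<Longrightarrow> X i \<in> sets M"
    by (auto simp: prod_algebra_eq_finite)
  have "emeasure (iid n F) A = (\<Prod>i<n. emeasure F (X i))" if "F \<in> space (prob_algebra M)" for F
  proof -
    interpret F: prob_space F
      using that by (simp add: space_prob_algebra)
    interpret product_sigma_finite "\<lambda>_. F"
      by standard
    show ?thesis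
      unfolding iid_def X(1) using that X(2) by (intro emeasure_PiM) (auto simp: space_prob_algebra)
  qed
  moreover have "(\<lambda>F. \<Prod>i<n. emeasure F (X i)) \<in> borel_measurable (prob_algebra M)"
  proof (intro borel_measurable_prod_ennreal)
    fix i assume "i \<in> {..<n}"
    then have "(\<lambda>F. emeasure F (X i)) \<in> borel_measurable (subprob_algebra M)"
      by (intro measurable_emeasure_subprob_algebra X) auto
    then show "(\<lambda>F. emeasure F (X i)) \<in> borel_measurable (prob_algebra M)"
      by (simp add: prob_algebra_def measurable_restrict_space1)
  qed
  ultimately show "(\<lambda>F. emeasure (iid n F) A) \<in> borel_measurable (prob_algebra M)"
    by (subst measurable_cong) auto
qed

text \<open>
  One hypothesis at a time: a distribution is drawn from the prior \<open>P\<close> on the class \<open>\<F>\<close>, then a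
  sample from the distribution. The locale is used once for the null and once for the alternative.
\<close>

locale randomized_sampling =
  fixes M :: "'a measure" and \<F> :: "'a measure set" and P :: "'a measure measure"
    and T :: "nat \<Rightarrow> (nat \<Rightarrow> 'a) \<Rightarrow> real"
  assumes prior: "prior_on M \<F> P"
    and statistic [measurable]: "T n \<in> borel_measurable (Pi\<^sub>M {..<n} (\<lambda>_. M))"
begin

sublocale prob_space P
  using prior by (simp add: prior_on_def)

lemma space_prior: "space P = \<F>"
  using prior by (simp add: prior_on_def)

lemma measurable_iid_prior: "iid n \<in> P \<rightarrow>\<^sub>M prob_algebra (Pi\<^sub>M {..<n} (\<lambda>_. M))"
proof -
  have "(\<lambda>F. F) \<in> P \<rightarrow>\<^sub>M prob_algebra M"
    using prior by (simp add: prior_on_def)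
  from measurable_compose[OF this measurable_iid] show ?thesis .
qed

lemma iid_prior:
  assumes "F \<in> \<F>"
  shows prob_space_iid: "prob_space (iid n F)"
    and sets_iid: "sets (iid n F) = sets (Pi\<^sub>M {..<n} (\<lambda>_. M))"
    and space_iid: "space (iid n F) = space (Pi\<^sub>M {..<n} (\<lambda>_. M))"
proof -
  have *: "iid n F \<in> space (prob_algebra (Pi\<^sub>M {..<n} (\<lambda>_. M)))"
    using measurable_space[OF measurable_iid_prior] assms by (simp add: space_prior)
  then show "prob_space (iid n F)" and s: "sets (iid n F) = sets (Pi\<^sub>M {..<n} (\<lambda>_. M))"
    by (auto simp: space_prob_algebra)
  show "space (iid n F) = space (Pi\<^sub>M {..<n} (\<lambda>_. M))"
    using sets_eq_imp_space_eq[OF s] .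
qed

lemma measurable_statistic_iid: "F \<in> \<F> \<Longrightarrow> T n \<in> borel_measurable (iid n F)"
  using statistic measurable_cong_sets[OF sets_iid refl] by blast

lemma reject_region [measurable]:
  "F \<in> \<F> \<Longrightarrow> {x \<in> space (iid n F). sqrt (real n) * T n x > t} \<in> sets (iid n F)"
  using measurable_statistic_iid by measurable

lemma accept_prob_eq: "F \<in> \<F> \<Longrightarrow> accept_prob T n F t = 1 - reject_prob T n F t"
proof -
  assume F: "F \<in> \<F>"
  interpret S: prob_space "iid n F" using prob_space_iid[OF F] .
  have "accept_prob T n F t
    = S.prob (space (iid n F) - {x \<in> space (iid n F). sqrt (real n) * T n x > t})"
    unfolding accept_prob_def by (intro arg_cong[of _ _ S.prob]) auto
  then show ?thesis
    using reject_region[OF F] by (simp add: S.prob_compl reject_prob_def)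
qed

lemma reject_prob_nonneg: "0 \<le> reject_prob T n F t"
  by (simp add: reject_prob_def)

lemma reject_prob_le_1: "F \<in> \<F> \<Longrightarrow> reject_prob T n F t \<le> 1"
  unfolding reject_prob_def using prob_space.prob_le_1[OF prob_space_iid] .

lemma accept_prob_nonneg: "0 \<le> accept_prob T n F t"
  by (simp add: accept_prob_def)

lemma accept_prob_le_1: "F \<in> \<F> \<Longrightarrow> accept_prob T n F t \<le> 1"
  unfolding accept_prob_def using prob_space.prob_le_1[OF prob_space_iid] .

lemma reject_prob_antimono: "F \<in> \<F> \<Longrightarrow> s \<le> t \<Longrightarrow> reject_prob T n F t \<le> reject_prob T n F s"
  unfolding reject_prob_def
  by (intro finite_measure.finite_measure_mono prob_space.finite_measure prob_space_iid reject_region) auto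

lemma measurable_reject_prob [measurable]: "(\<lambda>F. reject_prob T n F t) \<in> borel_measurable P"
proof -
  let ?N = "Pi\<^sub>M {..<n} (\<lambda>_. M)"
  let ?A = "{x \<in> space ?N. sqrt (real n) * T n x > t}"
  have "?A \<in> sets ?N"
    by measurable
  then have "(\<lambda>F. measure (iid n F) ?A) \<in> borel_measurable P"
    using measurable_compose[OF measurable_iid_prior measurable_measure_prob_algebra] by blast
  then show ?thesis
    by (rule measurable_cong[THEN iffD2, rotated]) (simp add: reject_prob_def space_prior space_iid)
qed

lemma measurable_accept_prob [measurable]: "(\<lambda>F. accept_prob T n F t) \<in> borel_measurable P"
proof -
  have "(\<lambda>F. 1 - reject_prob T n F t) \<in> borel_measurable P"
    by measurable
  then show ?thesis
    by (rule measurable_cong[THEN iffD2, rotated]) (simp add: accept_prob_eq space_prior)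
qed

lemma integrable_reject_prob: "integrable P (\<lambda>F. reject_prob T n F t)"
  by (intro integrable_const_bound[where B = 1])
    (auto simp: space_prior reject_prob_nonneg reject_prob_le_1)

lemma integrable_accept_prob: "integrable P (\<lambda>F. accept_prob T n F t)"
  by (intro integrable_const_bound[where B = 1])
    (auto simp: space_prior accept_prob_nonneg accept_prob_le_1)

lemma type_I_term_threshold_test:
  "type_I_term p L P n (threshold_test T n t) = p * L * (\<integral>F. reject_prob T n F t \<partial>P)"
  unfolding type_I_term_def threshold_test_def reject_prob_def
  by (auto simp: Int_def conj_commute)

lemma type_II_term_threshold_test:
  "type_II_term p L P n (threshold_test T n t) = p * L * (\<integral>F. accept_prob T n F t \<partial>P)"
proof -
  have "(\<integral>x. 1 - threshold_test T n t x \<partial>iid n F) = accept_prob T n F t" for F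
  proof -
    have "(\<lambda>x. 1 - threshold_test T n t x) = indicator {x. sqrt (real n) * T n x \<le> t}"
      by (auto simp: threshold_test_def indicator_def fun_eq_iff)
    then show ?thesis
      by (auto simp: accept_prob_def Int_def conj_commute)
  qed
  then show ?thesis
    by (simp add: type_II_term_def)
qed

lemma type_I_term_antimono:
  assumes "0 \<le> p" "0 \<le> L" "s \<le> t"
  shows "type_I_term p L P n (threshold_test T n t) \<le> type_I_term p L P n (threshold_test T n s)"
  unfolding type_I_term_threshold_test using assms
  by (intro mult_left_mono integral_mono integrable_reject_prob reject_prob_antimono)
    (auto simp: space_prior)

lemma type_II_term_mono:
  assumes "0 \<le> p" "0 \<le> L" "s \<le> t"
  shows "type_II_term p L P n (threshold_test T n s) \<le> type_II_term p L P n (threshold_test T n t)"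
  unfolding type_II_term_threshold_test using assms
  by (intro mult_left_mono integral_mono integrable_accept_prob)
    (auto simp: space_prior accept_prob_eq reject_prob_antimono)

lemma type_I_term_nonneg: "0 \<le> p \<Longrightarrow> 0 \<le> L \<Longrightarrow> 0 \<le> type_I_term p L P n (threshold_test T n t)"
  unfolding type_I_term_threshold_test by (simp add: reject_prob_def)

lemma type_II_term_nonneg: "0 \<le> p \<Longrightarrow> 0 \<le> L \<Longrightarrow> 0 \<le> type_II_term p L P n (threshold_test T n t)"
  unfolding type_II_term_threshold_test by (simp add: accept_prob_def)

end

section \<open>Type II error: prior mass near the null against the rate of detection\<close>

text \<open>
  Outside the ball of radius \<open>e\<close>, split the space into dyadic shells. The shell
  \<open>2 ^ j * e \<le> X < 2 ^ (j + 1) * e\<close> contributes a value of at most \<open>C * 2 powr (- \<gamma> * j)\<close> on a set of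
  probability at most \<open>K * (2 ^ (j + 1) * e) powr \<kappa>\<close>, and \<open>\<kappa> < \<gamma>\<close> makes the sum over \<open>j\<close> a
  convergent geometric series. So the mean is bounded by the order \<open>e powr \<kappa>\<close> of the innermost ball:
  points far away contribute no more than that.
\<close>

lemma (in prob_space) expectation_le_of_small_ball:
  fixes X f :: "'a \<Rightarrow> real"
  assumes [measurable]: "X \<in> borel_measurable M" "f \<in> borel_measurable M"
    and f01: "\<And>x. x \<in> space M \<Longrightarrow> 0 \<le> f x \<and> f x \<le> 1"
    and const: "0 \<le> K" "0 \<le> C" "\<kappa> < \<gamma>" "0 < \<gamma>" "0 < e"
    and ball: "\<And>r. 0 < r \<Longrightarrow> prob {x \<in> space M. X x \<le> r} \<le> K * r powr \<kappa>"
    and decay: "\<And>x. x \<in> space M \<Longrightarrow> e < X x \<Longrightarrow> f x \<le> C * (e / X x) powr \<gamma>"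
  shows "expectation f \<le> K * (1 + C * 2 powr \<kappa> / (1 - 2 powr (\<kappa> - \<gamma>))) * e powr \<kappa>"
proof -
  define q where "q = 2 powr (- \<gamma>)"
  define r where "r = 2 powr \<kappa>"
  define D where "D = K * e powr \<kappa>"
  have q: "0 < q" and r: "0 < r" and D: "0 \<le> D"
    using const by (auto simp: q_def r_def D_def)
  have qr: "q * r = 2 powr (\<kappa> - \<gamma>)" "q * r < 1"
    using const by (auto simp: q_def r_def powr_add[symmetric] powr_less_one)
  \<comment> \<open>the \<open>j\<close>-th shell is enlarged to the ball that contains it, so only ball masses occur\<close>
  let ?B = "\<lambda>s. {x \<in> space M. X x \<le> s}"
  let ?g = "\<lambda>j x. ennreal (C * q ^ j) * indicator (?B (2 ^ Suc j * e)) x"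
  have shell: "ennreal (f x) \<le> indicator (?B e) x + (\<Sum>j. ?g j x)" if x: "x \<in> space M" for x
  proof (cases "X x \<le> e")
    case True
    then show ?thesis
      using f01[OF x] x by (auto intro!: add_increasing2)
  next
    case False
    define m where "m = (LEAST m. X x / e < 2 ^ m)"
    have "\<exists>m. X x / e < 2 ^ m"
      by (rule real_arch_pow) simp
    then have m: "X x / e < 2 ^ m"
      unfolding m_def by (rule LeastI_ex)
    have "m \<noteq> 0"
      using m False const by (intro notI) (simp add: field_simps)
    then obtain j where j: "m = Suc j"
      by (cases m) auto
    have "2 ^ j \<le> X x / e"
      using not_less_Least[of j "\<lambda>m. X x / e < 2 ^ m"] j m_def by auto
    then have "e / X x \<le> 1 / 2 ^ j"
      using const False by (simp add: field_simps)
    then have "(e / X x) powr \<gamma> \<le> (1 / 2 ^ j) powr \<gamma>"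
      using const False by (intro powr_mono2) auto
    also have "\<dots> = q ^ j"
    proof -
      have "(1 / 2 ^ j :: real) = 2 powr (- real j)"
        by (simp add: powr_minus powr_realpow divide_inverse)
      then show ?thesis
        by (simp add: q_def powr_powr powr_power mult.commute)
    qed
    finally have "f x \<le> C * q ^ j"
      using decay[OF x] False const by (meson mult_left_mono not_le order_trans)
    moreover have "X x \<le> 2 ^ Suc j * e"
      using m j const by (simp add: field_simps)
    ultimately have "ennreal (f x) \<le> ?g j x"
      using x by (simp add: ennreal_leI)
    also have "\<dots> \<le> (\<Sum>j. ?g j x)"
      using sum_le_suminf[of "\<lambda>j. ?g j x" "{j}"]
      by (simp only: sum.insert sum.empty finite.emptyI finite.insertI empty_iff not_False_eq_True
          add_0_right summableI zero_le simp_thms)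
    finally show ?thesis
      by (simp add: add_increasing)
  qed
  have ball': "emeasure M (?B s) \<le> ennreal (K * s powr \<kappa>)" if "0 < s" for s
    using ball[OF that] by (simp add: emeasure_eq_measure ennreal_leI)
  have "ennreal (expectation f) = (\<integral>\<^sup>+x. f x \<partial>M)"
    using f01 by (intro nn_integral_eq_integral[symmetric] integrable_const_bound[where B = 1]) auto
  also have "\<dots> \<le> (\<integral>\<^sup>+x. indicator (?B e) x + (\<Sum>j. ?g j x) \<partial>M)"
    by (intro nn_integral_mono shell)
  also have "\<dots> = emeasure M (?B e) + (\<Sum>j. ennreal (C * q ^ j) * emeasure M (?B (2 ^ Suc j * e)))"
    by (subst nn_integral_add) (simp_all add: nn_integral_suminf nn_integral_cmult)
  also have "\<dots> \<le> ennreal D + (\<Sum>j. ennreal (C * D * r * (q * r) ^ j))"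
  proof (intro add_mono suminf_le summableI)
    show "emeasure M (?B e) \<le> ennreal D"
      using ball'[of e] const by (simp add: D_def)
    fix j
    have "ennreal (C * q ^ j) * emeasure M (?B (2 ^ Suc j * e))
        \<le> ennreal (C * q ^ j) * ennreal (K * (2 ^ Suc j * e) powr \<kappa>)"
      using const by (intro mult_left_mono ball') auto
    also have "(2 ^ Suc j * e) powr \<kappa> = r * r ^ j * e powr \<kappa>"
      using const by (simp add: powr_mult r_def powr_realpow[symmetric] powr_powr powr_power mult.commute)
    also have "ennreal (C * q ^ j) * ennreal (K * (r * r ^ j * e powr \<kappa>))
        = ennreal (C * D * r * (q * r) ^ j)"
      using const q r by (simp add: ennreal_mult[symmetric] D_def power_mult_distrib mult_ac)
    finally show "ennreal (C * q ^ j) * emeasure M (?B (2 ^ Suc j * e)) \<le> \<dots>" .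
  qed
  also have "(\<Sum>j. ennreal (C * D * r * (q * r) ^ j)) = ennreal (\<Sum>j. C * D * r * (q * r) ^ j)"
    using const q r D qr(2) by (intro suminf_ennreal2 summable_mult summable_geometric) auto
  also have "(\<Sum>j. C * D * r * (q * r) ^ j) = C * D * r / (1 - q * r)"
    using q r qr(2) by (subst suminf_mult) (auto simp: suminf_geometric summable_geometric)
  also have "ennreal D + ennreal (C * D * r / (1 - q * r)) = ennreal (D + C * D * r / (1 - q * r))"
    using D const q r qr(2) by (intro ennreal_plus[symmetric]) auto
  finally have "expectation f \<le> D + C * D * r / (1 - q * r)"
    using D const q r qr(2) by (subst (asm) ennreal_le_iff) (auto intro!: add_nonneg_nonneg)
  then show ?thesis
    by (simp add: qr(1)[symmetric] D_def r_def algebra_simps)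
qed

section \<open>Orders of magnitude in threshold windows\<close>

text \<open>
  The order of magnitude of \<open>f\<close> is given by \<open>g\<close> uniformly over the thresholds \<open>t\<^sub>0 \<le> t \<le> A * sqrt (ln n)\<close>;
  the constants may depend on \<open>A\<close>. All thresholds of order \<open>sqrt (ln n)\<close> lie in such a window, so
  the uniform statement can be evaluated along a threshold \<open>log_threshold (a n) n\<close> where \<open>a\<close> varies with \<open>n\<close>.
\<close>

definition window_order :: "(nat \<Rightarrow> real \<Rightarrow> real) \<Rightarrow> (nat \<Rightarrow> real \<Rightarrow> real) \<Rightarrow> bool" where
  "window_order f g \<longleftrightarrow> (\<forall>A>0. \<exists>c>0. \<exists>C>0. \<exists>t0>0. \<forall>\<^sub>F n in sequentially.
    \<forall>t\<in>{t0..A * sqrt (ln (real n))}. c * g n t \<le> f n t \<and> f n t \<le> C * g n t)"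

lemma window_orderE:
  assumes "window_order f g" "0 < A"
  obtains c C t0 where "0 < c" "0 < C" "0 < t0"
    "\<forall>\<^sub>F n in sequentially. \<forall>t\<in>{t0..A * sqrt (ln (real n))}. c * g n t \<le> f n t \<and> f n t \<le> C * g n t"
  using assms unfolding window_order_def by blast

lemma window_order_add:
  assumes f: "window_order f1 g1" "window_order f2 g2"
    and nonneg: "\<And>n t. 0 \<le> g1 n t" "\<And>n t. 0 \<le> g2 n t"
  shows "window_order (\<lambda>n t. f1 n t + f2 n t) (\<lambda>n t. g1 n t + g2 n t)"
  unfolding window_order_def
proof (intro allI impI)
  fix A :: real assume A: "0 < A"
  obtain c1 C1 t1 where 1: "0 < c1" "0 < C1" "0 < t1" and
    e1: "\<forall>\<^sub>F n in sequentially. \<forall>t\<in>{t1..A * sqrt (ln (real n))}. c1 * g1 n t \<le> f1 n t \<and> f1 n t \<le> C1 * g1 n t"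
    using window_orderE[OF f(1) A] by blast
  obtain c2 C2 t2 where 2: "0 < c2" "0 < C2" "0 < t2" and
    e2: "\<forall>\<^sub>F n in sequentially. \<forall>t\<in>{t2..A * sqrt (ln (real n))}. c2 * g2 n t \<le> f2 n t \<and> f2 n t \<le> C2 * g2 n t"
    using window_orderE[OF f(2) A] by blast
  show "\<exists>c>0. \<exists>C>0. \<exists>t0>0. \<forall>\<^sub>F n in sequentially. \<forall>t\<in>{t0..A * sqrt (ln (real n))}.
    c * (g1 n t + g2 n t) \<le> f1 n t + f2 n t \<and> f1 n t + f2 n t \<le> C * (g1 n t + g2 n t)"
  proof (intro exI conjI)
    show "\<forall>\<^sub>F n in sequentially. \<forall>t\<in>{max t1 t2..A * sqrt (ln (real n))}.
      min c1 c2 * (g1 n t + g2 n t) \<le> f1 n t + f2 n t \<and> f1 n t + f2 n t \<le> max C1 C2 * (g1 n t + g2 n t)"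
      using e1 e2
    proof eventually_elim
      case (elim n)
      show ?case
      proof
        fix t assume "t \<in> {max t1 t2..A * sqrt (ln (real n))}"
        then have "c1 * g1 n t \<le> f1 n t" "f1 n t \<le> C1 * g1 n t" "c2 * g2 n t \<le> f2 n t" "f2 n t \<le> C2 * g2 n t"
          using elim by auto
        moreover have "min c1 c2 * g1 n t \<le> c1 * g1 n t" "min c1 c2 * g2 n t \<le> c2 * g2 n t"
          "C1 * g1 n t \<le> max C1 C2 * g1 n t" "C2 * g2 n t \<le> max C1 C2 * g2 n t"
          using nonneg by (auto intro!: mult_right_mono)
        ultimately show "min c1 c2 * (g1 n t + g2 n t) \<le> f1 n t + f2 n t
            \<and> f1 n t + f2 n t \<le> max C1 C2 * (g1 n t + g2 n t)"
          unfolding distrib_left by linarith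
      qed
    qed
  qed (use 1 2 in auto)
qed

lemma window_order_cmult:
  assumes f: "window_order f g" and k: "0 < k"
  shows "window_order (\<lambda>n t. k * f n t) g"
  unfolding window_order_def
proof (intro allI impI)
  fix A :: real assume A: "0 < A"
  obtain c C t0 where 1: "0 < c" "0 < C" "0 < t0" and
    e: "\<forall>\<^sub>F n in sequentially. \<forall>t\<in>{t0..A * sqrt (ln (real n))}. c * g n t \<le> f n t \<and> f n t \<le> C * g n t"
    using window_orderE[OF f A] by blast
  show "\<exists>c>0. \<exists>C>0. \<exists>t0>0. \<forall>\<^sub>F n in sequentially. \<forall>t\<in>{t0..A * sqrt (ln (real n))}.
    c * g n t \<le> k * f n t \<and> k * f n t \<le> C * g n t"
  proof (intro exI conjI)
    show "\<forall>\<^sub>F n in sequentially. \<forall>t\<in>{t0..A * sqrt (ln (real n))}.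
      (k * c) * g n t \<le> k * f n t \<and> k * f n t \<le> (k * C) * g n t"
      using e by (rule eventually_mono) (use k in \<open>auto simp: mult.assoc\<close>)
  qed (use 1 k in auto)
qed

text \<open>
  The limit \<open>a0\<close> has to be positive: it keeps \<open>log_threshold (a n) n\<close> above every fixed \<open>t0\<close>.
\<close>

lemma eventually_log_threshold_in_window:
  assumes a: "a \<longlonglongrightarrow> a0" "0 < a0"
  shows "\<forall>\<^sub>F n in sequentially. log_threshold (a n) n \<in> {t0..sqrt (a0 + 1) * sqrt (ln (real n))}"
proof -
  have "\<forall>\<^sub>F n in sequentially. a0 / 2 < a n" "\<forall>\<^sub>F n in sequentially. a n < a0 + 1"
    using order_tendstoD(1)[OF a(1), of "a0 / 2"] order_tendstoD(2)[OF a(1), of "a0 + 1"] a(2) by simp_all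
  moreover have "\<forall>\<^sub>F n in sequentially. t0 < sqrt (a0 / 2) * sqrt (ln (real n))"
    using a(2) by real_asymp
  moreover have "\<forall>\<^sub>F n in sequentially. 0 < ln (real n)"
    by real_asymp
  ultimately show ?thesis
  proof eventually_elim
    case (elim n)
    have "sqrt (a0 / 2) * sqrt (ln (real n)) \<le> log_threshold (a n) n"
      using elim by (simp add: log_threshold_def real_sqrt_mult[symmetric])
    moreover have "log_threshold (a n) n \<le> sqrt (a0 + 1) * sqrt (ln (real n))"
      using elim by (simp add: log_threshold_def real_sqrt_mult[symmetric])
    ultimately show ?case
      using elim by simp
  qed
qed

lemma bigtheta_log_threshold:
  assumes f: "window_order f g" and nonneg: "\<And>n t. 0 \<le> g n t"
    and a: "a \<longlonglongrightarrow> a0" "0 < a0"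
  shows "(\<lambda>n. f n (log_threshold (a n) n)) \<in> \<Theta>(\<lambda>n. g n (log_threshold (a n) n))"
proof -
  obtain c C t0 where 1: "0 < c" "0 < C" "0 < t0" and
    e: "\<forall>\<^sub>F n in sequentially. \<forall>t\<in>{t0..sqrt (a0 + 1) * sqrt (ln (real n))}.
      c * g n t \<le> f n t \<and> f n t \<le> C * g n t"
    using window_orderE[OF f, of "sqrt (a0 + 1)"] a by auto
  have *: "\<forall>\<^sub>F n in sequentially. c * g n (log_threshold (a n) n) \<le> f n (log_threshold (a n) n)
      \<and> f n (log_threshold (a n) n) \<le> C * g n (log_threshold (a n) n)"
    using e eventually_log_threshold_in_window[OF a, of t0] by eventually_elim blast
  show ?thesis
  proof (rule bigthetaI')
    show "\<forall>\<^sub>F n in sequentially. c * norm (g n (log_threshold (a n) n)) \<le> norm (f n (log_threshold (a n) n))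
      \<and> norm (f n (log_threshold (a n) n)) \<le> C * norm (g n (log_threshold (a n) n))"
      using * 
    proof eventually_elim
      case (elim n)
      moreover have "0 \<le> c * g n (log_threshold (a n) n)"
        using 1 nonneg by simp
      ultimately show ?case
        using nonneg by (auto simp: abs_of_nonneg)
    qed
  qed (use 1 in auto)
qed

lemma exp_log_threshold:
  assumes "0 < n" "0 \<le> a"
  shows "exp (- 2 * \<rho> * (log_threshold a n)\<^sup>2) = real n powr (- 2 * \<rho> * a)"
  using assms by (simp add: log_threshold_def powr_def mult_ac)

lemma powr_log_threshold:
  assumes "0 < n" "0 \<le> a"
  shows "(log_threshold a n / sqrt (real n)) powr \<kappa> = (a * ln (real n) / real n) powr (\<kappa> / 2)"
proof -
  have "log_threshold a n / sqrt (real n) = (a * ln (real n) / real n) powr (1 / 2)"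
    using assms by (simp add: log_threshold_def real_sqrt_divide[symmetric] powr_half_sqrt)
  then show ?thesis
    by (simp add: powr_powr)
qed

lemma bigtheta_exp_log_threshold:
  assumes f: "window_order f (\<lambda>n t. exp (- 2 * \<rho> * t\<^sup>2))" and a: "a \<longlonglongrightarrow> a0" "0 < a0"
  shows "(\<lambda>n. f n (log_threshold (a n) n)) \<in> \<Theta>(\<lambda>n. real n powr (- 2 * \<rho> * a n))"
proof -
  have *: "\<forall>\<^sub>F n in sequentially. exp (- 2 * \<rho> * (log_threshold (a n) n)\<^sup>2) = real n powr (- 2 * \<rho> * a n)"
    using eventually_gt_at_top[of 0] order_tendstoD(1)[OF a]
    by eventually_elim (intro exp_log_threshold, auto)
  show ?thesis
    using bigtheta_log_threshold[OF f _ a] unfolding landau_theta.cong[OF *] by simp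
qed

lemma bigtheta_powr_log_threshold:
  assumes f: "window_order f (\<lambda>n t. (t / sqrt (real n)) powr \<kappa>)" and a: "a \<longlonglongrightarrow> a0" "0 < a0"
  shows "(\<lambda>n. f n (log_threshold (a n) n)) \<in> \<Theta>(\<lambda>n. (a n * ln (real n) / real n) powr (\<kappa> / 2))"
proof -
  have *: "\<forall>\<^sub>F n in sequentially. (log_threshold (a n) n / sqrt (real n)) powr \<kappa>
      = (a n * ln (real n) / real n) powr (\<kappa> / 2)"
    using eventually_gt_at_top[of 0] order_tendstoD(1)[OF a]
    by eventually_elim (intro powr_log_threshold, auto)
  show ?thesis
    using bigtheta_log_threshold[OF f _ a] unfolding landau_theta.cong[OF *] by simp
qed

text \<open>
  Only exponents survive this normalisation: the constants of the order contribute
  \<open>O(1 / ln n)\<close>. It applies to sequences whose exponent varies with \<open>n\<close>, where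
  the powers \<open>n powr e n\<close> and \<open>n powr e0\<close> may differ by a power of \<open>ln n\<close>.
\<close>

lemma bigtheta_powr_ln_ratio:
  fixes f e :: "nat \<Rightarrow> real"
  assumes f: "f \<in> \<Theta>(\<lambda>n. real n powr e n)" "\<And>n. 0 \<le> f n" and e: "e \<longlonglongrightarrow> e0"
  shows "(\<lambda>n. ln (f n) / ln (real n)) \<longlonglongrightarrow> e0"
proof -
  obtain C where C: "0 < C" "\<forall>\<^sub>F n in sequentially. norm (f n) \<le> C * norm (real n powr e n)"
    using bigthetaD1[OF f(1)] by (rule landau_o.bigE)
  obtain c where c: "0 < c" "\<forall>\<^sub>F n in sequentially. norm (f n) \<ge> c * norm (real n powr e n)"
    using bigthetaD2[OF f(1), unfolded bigomega_iff_bigo[symmetric]] by (rule landau_omega.bigE)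
  have n: "\<forall>\<^sub>F n in sequentially. 1 < real n"
    by real_asymp
  have bounds: "\<forall>\<^sub>F n in sequentially. ln c / ln (real n) + e n \<le> ln (f n) / ln (real n)
      \<and> ln (f n) / ln (real n) \<le> ln C / ln (real n) + e n"
    using C(2) c(2) n
  proof eventually_elim
    case (elim n)
    then have L: "0 < ln (real n)" and lo: "c * real n powr e n \<le> f n" and up: "f n \<le> C * real n powr e n"
      using f(2)[of n] by auto
    have pos: "0 < c * real n powr e n"
      using elim c by simp
    have "ln (c * real n powr e n) \<le> ln (f n)"
      using lo pos by (subst ln_le_cancel_iff) auto
    moreover have "ln (f n) \<le> ln (C * real n powr e n)"
      using lo up pos by (subst ln_le_cancel_iff) auto
    ultimately show ?case
      using elim C(1) c(1) L by (simp add: ln_mult ln_powr le_divide_eq divide_le_eq distrib_right)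
  qed
  have inv: "(\<lambda>n. k / ln (real n) + e n) \<longlonglongrightarrow> e0" for k
  proof -
    have "(\<lambda>n. k / ln (real n)) \<longlonglongrightarrow> 0"
      by real_asymp
    from tendsto_add[OF this e] show ?thesis
      by simp
  qed
  show ?thesis
    by (rule tendsto_sandwich[OF _ _ inv inv]) (use bounds in \<open>auto elim: eventually_mono\<close>)
qed

section \<open>Orders of the two error terms\<close>

text \<open>
  The null tail is uniform over the null class, so it survives averaging over any prior on it.
\<close>

lemma (in randomized_sampling) window_order_type_I_term:
  assumes tail: "subgaussian_null_tail T \<F> \<rho>" and pos: "0 < p" "0 < L"
  shows "window_order (\<lambda>n t. type_I_term p L P n (threshold_test T n t)) (\<lambda>n t. exp (- 2 * \<rho> * t\<^sup>2))"
proof -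
  have "window_order (\<lambda>n t. \<integral>F. reject_prob T n F t \<partial>P) (\<lambda>n t. exp (- 2 * \<rho> * t\<^sup>2))"
    unfolding window_order_def
  proof (intro allI impI)
    fix A :: real assume "0 < A"
    then obtain c C t0 where 1: "0 < c" "0 < C" "0 < t0" and
      e: "\<forall>\<^sub>F n in sequentially. \<forall>F\<in>\<F>. \<forall>t\<in>{t0..A * sqrt (ln (real n))}.
        c * exp (- 2 * \<rho> * t\<^sup>2) \<le> reject_prob T n F t \<and> reject_prob T n F t \<le> C * exp (- 2 * \<rho> * t\<^sup>2)"
      using tail unfolding subgaussian_null_tail_def by blast
    have "\<forall>\<^sub>F n in sequentially. \<forall>t\<in>{t0..A * sqrt (ln (real n))}.
        c * exp (- 2 * \<rho> * t\<^sup>2) \<le> (\<integral>F. reject_prob T n F t \<partial>P)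
        \<and> (\<integral>F. reject_prob T n F t \<partial>P) \<le> C * exp (- 2 * \<rho> * t\<^sup>2)"
      using e
      by eventually_elim
        (intro ballI conjI integral_ge_const integral_le_const integrable_reject_prob AE_I2,
          auto simp: space_prior)
    with 1 show "\<exists>c>0. \<exists>C>0. \<exists>t0>0. \<forall>\<^sub>F n in sequentially. \<forall>t\<in>{t0..A * sqrt (ln (real n))}.
        c * exp (- 2 * \<rho> * t\<^sup>2) \<le> (\<integral>F. reject_prob T n F t \<partial>P)
        \<and> (\<integral>F. reject_prob T n F t \<partial>P) \<le> C * exp (- 2 * \<rho> * t\<^sup>2)"
      by blast
  qed
  then show ?thesis
    unfolding type_I_term_threshold_test using pos by (intro window_order_cmult) auto
qed

lemma window_order_reject_prob:
  assumes tail: "subgaussian_null_tail T \<F>0 \<rho>" and F: "F \<in> \<F>0"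
  shows "window_order (\<lambda>n. reject_prob T n F) (\<lambda>n t. exp (- 2 * \<rho> * t\<^sup>2))"
  unfolding window_order_def
proof (intro allI impI)
  fix A :: real assume "0 < A"
  then obtain c C t0 where 1: "0 < c" "0 < C" "0 < t0" and
    e: "\<forall>\<^sub>F n in sequentially. \<forall>F\<in>\<F>0. \<forall>t\<in>{t0..A * sqrt (ln (real n))}.
      c * exp (- 2 * \<rho> * t\<^sup>2) \<le> reject_prob T n F t \<and> reject_prob T n F t \<le> C * exp (- 2 * \<rho> * t\<^sup>2)"
    using tail unfolding subgaussian_null_tail_def by blast
  from e have "\<forall>\<^sub>F n in sequentially. \<forall>t\<in>{t0..A * sqrt (ln (real n))}.
      c * exp (- 2 * \<rho> * t\<^sup>2) \<le> reject_prob T n F t \<and> reject_prob T n F t \<le> C * exp (- 2 * \<rho> * t\<^sup>2)"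
    by (rule eventually_mono) (use F in blast)
  with 1 show "\<exists>c>0. \<exists>C>0. \<exists>t0>0. \<forall>\<^sub>F n in sequentially. \<forall>t\<in>{t0..A * sqrt (ln (real n))}.
      c * exp (- 2 * \<rho> * t\<^sup>2) \<le> reject_prob T n F t \<and> reject_prob T n F t \<le> C * exp (- 2 * \<rho> * t\<^sup>2)"
    by blast
qed

text \<open>
  With \<open>e = t / sqrt n\<close> the scale of detection, alternatives within distance \<open>k * e\<close> are accepted
  with probability bounded below and carry mass of order \<open>e powr \<kappa>\<close>; this gives the lower bound.
  For the upper bound, the acceptance probability decays like \<open>(e / distance) powr \<gamma>\<close> with
  \<open>\<kappa> < \<gamma>\<close>, so the dyadic estimate shows that all alternatives together contribute no more than this order.
\<close>

lemma (in randomized_sampling) window_order_type_II_term: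
  assumes dist [measurable]: "set_distance d \<F>0 \<in> borel_measurable P"
    and mass: "polynomial_prior_mass d \<F>0 P \<kappa>"
    and rate: "detection_rate T d \<F>0 \<F> \<kappa>"
    and undetected: "undetected_below_scale T d \<F>0 \<F>"
    and pos: "0 < \<kappa>" "0 < p" "0 < L"
  shows "window_order (\<lambda>n t. type_II_term p L P n (threshold_test T n t)) (\<lambda>n t. (t / sqrt (real n)) powr \<kappa>)"
proof -
  let ?X = "set_distance d \<F>0"
  let ?ball = "\<lambda>r. {F \<in> space P. ?X F \<le> r}"
  obtain c1 C1 \<epsilon>0 where c1: "0 < c1" "0 < C1" "0 < \<epsilon>0" and
    ball: "\<And>\<epsilon>. 0 < \<epsilon> \<Longrightarrow> \<epsilon> \<le> \<epsilon>0 \<Longrightarrow> c1 * \<epsilon> powr \<kappa> \<le> prob (?ball \<epsilon>) \<and> prob (?ball \<epsilon>) \<le> C1 * \<epsilon> powr \<kappa>"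
    using mass unfolding polynomial_prior_mass_def by fastforce
  \<comment> \<open>beyond \<open>\<epsilon>0\<close> the power \<open>(r / \<epsilon>0) powr \<kappa>\<close> is at least 1, so that a larger constant extends the
    upper bound on the mass of balls to every radius\<close>
  define K where "K = max C1 (\<epsilon>0 powr (- \<kappa>))"
  have K: "0 < K"
    using c1 by (simp add: K_def)
  have ball_le: "prob (?ball r) \<le> K * r powr \<kappa>" if r: "0 < r" for r
  proof (cases "r \<le> \<epsilon>0")
    case True
    then have "prob (?ball r) \<le> C1 * r powr \<kappa>"
      using ball r by simp
    also have "\<dots> \<le> K * r powr \<kappa>"
      by (intro mult_right_mono) (auto simp: K_def)
    finally show ?thesis .
  next
    case False
    have "prob (?ball r) \<le> 1"
      by simp
    also have "1 = \<epsilon>0 powr (- \<kappa>) * \<epsilon>0 powr \<kappa>"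
      using c1 by (simp add: powr_add[symmetric])
    also have "\<dots> \<le> K * r powr \<kappa>"
      using False c1 pos K by (intro mult_mono powr_mono2) (auto simp: K_def)
    finally show ?thesis .
  qed
  have "window_order (\<lambda>n t. \<integral>F. accept_prob T n F t \<partial>P) (\<lambda>n t. (t / sqrt (real n)) powr \<kappa>)"
    unfolding window_order_def
  proof (intro allI impI)
    fix A :: real assume A: "0 < A"
    obtain \<gamma> C t1 where 1: "\<kappa> < \<gamma>" "0 < C" "0 < t1" and
      e1: "\<forall>\<^sub>F n in sequentially. \<forall>F\<in>\<F>. \<forall>t\<in>{t1..A * sqrt (ln (real n))}. t < ?X F * sqrt (real n) \<longrightarrow>
        accept_prob T n F t \<le> C * (t / (?X F * sqrt (real n))) powr \<gamma>"
      using rate A unfolding detection_rate_def by blast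
    obtain k c t2 where 2: "0 < k" "0 < c" "0 < t2" and
      e2: "\<forall>\<^sub>F n in sequentially. \<forall>F\<in>\<F>. \<forall>t\<in>{t2..A * sqrt (ln (real n))}. ?X F * sqrt (real n) \<le> k * t \<longrightarrow>
        c \<le> accept_prob T n F t"
      using undetected A unfolding undetected_below_scale_def by blast
    have "\<forall>\<^sub>F n in sequentially. k * (A * sqrt (ln (real n))) / sqrt (real n) < \<epsilon>0"
      using A 2 c1 by real_asymp
    moreover have "\<forall>\<^sub>F n in sequentially. 0 < real n"
      by real_asymp
    ultimately have "\<forall>\<^sub>F n in sequentially. \<forall>t\<in>{max t1 t2..A * sqrt (ln (real n))}.
        (c * c1 * k powr \<kappa>) * (t / sqrt (real n)) powr \<kappa> \<le> (\<integral>F. accept_prob T n F t \<partial>P)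
        \<and> (\<integral>F. accept_prob T n F t \<partial>P)
          \<le> (K * (1 + C * 2 powr \<kappa> / (1 - 2 powr (\<kappa> - \<gamma>)))) * (t / sqrt (real n)) powr \<kappa>"
      using e1 e2
    proof eventually_elim
      case (elim n)
      show ?case
      proof (intro ballI conjI)
        fix t assume t: "t \<in> {max t1 t2..A * sqrt (ln (real n))}"
        define e where "e = t / sqrt (real n)"
        have n: "0 < sqrt (real n)" and t0: "0 < t" and e: "0 < e"
          using elim t 1 by (auto simp: e_def)
        show "(\<integral>F. accept_prob T n F t \<partial>P) \<le> (K * (1 + C * 2 powr \<kappa> / (1 - 2 powr (\<kappa> - \<gamma>)))) * e powr \<kappa>"
        proof (rule expectation_le_of_small_ball[OF dist measurable_accept_prob])
          show "0 \<le> accept_prob T n F t \<and> accept_prob T n F t \<le> 1" if "F \<in> space P" for F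
            using that accept_prob_nonneg accept_prob_le_1 by (simp add: space_prior)
          show "accept_prob T n F t \<le> C * (e / ?X F) powr \<gamma>" if F: "F \<in> space P" "e < ?X F" for F
          proof -
            have "t < ?X F * sqrt (real n)"
              using F n by (simp add: e_def field_simps)
            then have "accept_prob T n F t \<le> C * (t / (?X F * sqrt (real n))) powr \<gamma>"
              using elim F t by (simp add: space_prior)
            then show ?thesis
              by (simp add: e_def mult.commute)
          qed
        qed (use K 1 pos e ball_le in auto)
        have "k * t \<le> k * (A * sqrt (ln (real n)))"
          using t 2 by (intro mult_left_mono) auto
        then have "k * e \<le> k * (A * sqrt (ln (real n))) / sqrt (real n)"
          using n by (simp add: e_def divide_right_mono)
        then have ke: "0 < k * e" "k * e \<le> \<epsilon>0"
          using elim e 2 by auto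
        have "(c * c1 * k powr \<kappa>) * e powr \<kappa> = c * (c1 * (k * e) powr \<kappa>)"
          using 2 e by (simp add: powr_mult)
        also have "\<dots> \<le> c * prob (?ball (k * e))"
          using ball[OF ke] 2 by simp
        also have "\<dots> = (\<integral>F. c * indicator (?ball (k * e)) F \<partial>P)"
          by (simp add: Int_def conj_commute)
        also have "\<dots> \<le> (\<integral>F. accept_prob T n F t \<partial>P)"
        proof (intro integral_mono integrable_accept_prob)
          show "integrable P (\<lambda>F. c * indicator (?ball (k * e)) F)"
            by (intro integrable_mult_right integrable_real_indicator) (auto simp: emeasure_eq_measure)
          fix F assume F: "F \<in> space P"
          have "c \<le> accept_prob T n F t" if "?X F \<le> k * e"
          proof -
            have "?X F * sqrt (real n) \<le> k * t"
              using that n by (simp add: e_def field_simps)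
            then show ?thesis
              using elim F t by (simp add: space_prior)
          qed
          then show "c * indicator (?ball (k * e)) F \<le> accept_prob T n F t"
            using accept_prob_nonneg by (auto simp: indicator_def)
        qed
        finally show "(c * c1 * k powr \<kappa>) * e powr \<kappa> \<le> (\<integral>F. accept_prob T n F t \<partial>P)" .
      qed
    qed
    moreover have "0 < K * (1 + C * 2 powr \<kappa> / (1 - 2 powr (\<kappa> - \<gamma>)))"
      using K 1 by (intro mult_pos_pos add_pos_nonneg) (auto simp: powr_less_one less_imp_le)
    ultimately show "\<exists>c>0. \<exists>C>0. \<exists>t0>0. \<forall>\<^sub>F n in sequentially. \<forall>t\<in>{t0..A * sqrt (ln (real n))}.
        c * (t / sqrt (real n)) powr \<kappa> \<le> (\<integral>F. accept_prob T n F t \<partial>P)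
        \<and> (\<integral>F. accept_prob T n F t \<partial>P) \<le> C * (t / sqrt (real n)) powr \<kappa>"
      using 1 2 c1 by (intro exI[of _ "c * c1 * k powr \<kappa>"] conjI
          exI[of _ "K * (1 + C * 2 powr \<kappa> / (1 - 2 powr (\<kappa> - \<gamma>)))"] exI[of _ "max t1 t2"]) auto
  qed
  then show ?thesis
    unfolding type_II_term_threshold_test using pos by (intro window_order_cmult) auto
qed

section \<open>Minimising the risk rate\<close>

text \<open>
  At \<open>a = \<kappa> / (4 * \<rho>)\<close> the polynomial orders in \<open>n\<close> of the two terms coincide; the logarithm makes
  the second term the larger one for large \<open>n\<close>.
\<close>

lemma risk_rate_at_balance:
  assumes "0 < \<rho>" "0 < \<kappa>"
  shows "risk_rate \<rho> \<kappa> n (\<kappa> / (4 * \<rho>))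
    = real n powr (- \<kappa> / 2) + (\<kappa> / (4 * \<rho>) * ln (real n) / real n) powr (\<kappa> / 2)"
  using assms by (simp add: risk_rate_def)

lemma type_II_rate_le_risk_rate: "(a * ln (real n) / real n) powr (\<kappa> / 2) \<le> risk_rate \<rho> \<kappa> n a"
  by (simp add: risk_rate_def)

lemma type_I_rate_le_risk_rate: "real n powr (- 2 * \<rho> * a) \<le> risk_rate \<rho> \<kappa> n a"
  by (simp add: risk_rate_def)

lemma risk_rate_balance_bigo:
  assumes "0 < \<rho>" "0 < \<kappa>"
  shows "(\<lambda>n. risk_rate \<rho> \<kappa> n (\<kappa> / (4 * \<rho>))) \<in> O(\<lambda>n. (ln (real n) / real n) powr (\<kappa> / 2))"
  unfolding risk_rate_at_balance[OF assms] using assms by real_asymp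

text \<open>
  The rate is 1 at \<open>a = 0\<close> (where the second term is \<open>0 powr (\<kappa> / 2) = 0\<close>) and its second term alone
  is at least 1 for \<open>a \<ge> n / ln n\<close>, so the search is confined to a compact interval.
\<close>

lemma risk_rate_attains_min:
  assumes "0 < \<kappa>" "2 \<le> n"
  shows "\<exists>a. is_arg_min (risk_rate \<rho> \<kappa> n) (\<lambda>a. a \<ge> 0) a"
proof -
  have n: "0 < ln (real n)" "0 < real n"
    using assms by auto
  have "continuous_on {0..real n / ln (real n)} (risk_rate \<rho> \<kappa> n)"
    unfolding risk_rate_def using assms n
    by (intro continuous_on_add continuous_on_powr' continuous_on_mult continuous_on_divide
        continuous_on_const continuous_on_id) auto
  moreover have "compact {0..real n / ln (real n)}" "{0..real n / ln (real n)} \<noteq> {}"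
    using n by auto
  ultimately obtain a where a: "a \<in> {0..real n / ln (real n)}"
    and min: "\<And>b. b \<in> {0..real n / ln (real n)} \<Longrightarrow> risk_rate \<rho> \<kappa> n a \<le> risk_rate \<rho> \<kappa> n b"
    using continuous_attains_inf by metis
  have "risk_rate \<rho> \<kappa> n a \<le> risk_rate \<rho> \<kappa> n b" if b: "0 \<le> b" for b
  proof (cases "b \<le> real n / ln (real n)")
    case False
    have "risk_rate \<rho> \<kappa> n a \<le> risk_rate \<rho> \<kappa> n 0"
      using n by (intro min) auto
    also have "\<dots> = 1"
      using n by (simp add: risk_rate_def)
    also have "1 \<le> (b * ln (real n) / real n) powr (\<kappa> / 2)"
      using False n assms by (intro ge_one_powr_ge_zero) (auto simp: field_simps)
    also have "\<dots> \<le> risk_rate \<rho> \<kappa> n b"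
      by (rule type_II_rate_le_risk_rate)
    finally show ?thesis .
  qed (use min b in auto)
  then show ?thesis
    using a by (auto simp: is_arg_min_def not_less intro!: exI[of _ a])
qed

lemma arg_min_risk_rate_le:
  "is_arg_min (risk_rate \<rho> \<kappa> n) (\<lambda>a. a \<ge> 0) a \<Longrightarrow> 0 \<le> b \<Longrightarrow> risk_rate \<rho> \<kappa> n a \<le> risk_rate \<rho> \<kappa> n b"
  by (meson is_arg_min_def not_less)

lemma arg_min_risk_rate_nonneg: "is_arg_min (risk_rate \<rho> \<kappa> n) (\<lambda>a. a \<ge> 0) a \<Longrightarrow> 0 \<le> a"
  by (simp add: is_arg_min_def)

text \<open>
  Let \<open>a0 = \<kappa> / (4 * \<rho>)\<close>, \<open>p = \<kappa> / 2\<close> and \<open>L = ln n\<close>. Each side uses one term of the rate and one competitor.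
  From below: the first term at the minimiser is at most the rate at \<open>a0\<close>, which has order
  \<open>(L / n) powr p\<close>; take logarithms. From above: the second term at the minimiser is at most the rate
  at \<open>b = a0 + ln L / (2 * \<rho> * L)\<close>. The competitor \<open>a0\<close> itself would be too weak here,
  since its first term, relative to \<open>(L / n) powr p\<close>, is only \<open>L powr (- p)\<close>, of larger
  order than \<open>ln L / L\<close> when \<open>p < 1\<close>; the shift gains the factor \<open>1 / L\<close>.
\<close>

lemma arg_min_risk_rate_asymp:
  assumes pos: "0 < \<rho>" "0 < \<kappa>"
    and a: "\<forall>\<^sub>F n in sequentially. is_arg_min (risk_rate \<rho> \<kappa> n) (\<lambda>a. a \<ge> 0) (a n)"
  shows "(\<lambda>n. a n - \<kappa> / (4 * \<rho>)) \<in> O(\<lambda>n. ln (ln (real n)) / ln (real n))"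
proof -
  define a0 where "a0 = \<kappa> / (4 * \<rho>)"
  define p where "p = \<kappa> / 2"
  have p: "0 < p" "0 < a0" "2 * \<rho> * a0 = p"
    using pos by (auto simp: a0_def p_def)
  define b where "b n = a0 + ln (ln (real n)) / (2 * \<rho> * ln (real n))" for n :: nat
  \<comment> \<open>twice the shift of \<open>b\<close>: the additional shift absorbs the term \<open>1 / L\<close>\<close>
  define h where "h n = a0 + ln (ln (real n)) / (\<rho> * ln (real n))" for n :: nat
  have h: "\<forall>\<^sub>F n in sequentially. b n powr p + 1 / ln (real n) \<le> h n powr p"
    unfolding h_def b_def using p pos by real_asymp
  have upper: "\<forall>\<^sub>F n in sequentially. a n \<le> h n"
  proof -
    have "\<forall>\<^sub>F n in sequentially. 1 < ln (real n)" by real_asymp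
    moreover have "\<forall>\<^sub>F n in sequentially. 1 < real n" by real_asymp
    ultimately show ?thesis
      using a h
    proof eventually_elim
      case (elim n)
      define L where "L = ln (real n)"
      have L: "1 < L" and n: "0 < real n" using elim by (auto simp: L_def)
      have hn: "0 < h n"
        using p pos L by (auto simp: h_def L_def[symmetric] intro!: add_pos_nonneg)
      have bn: "0 < b n"
        using p pos L by (auto simp: b_def L_def[symmetric] intro!: add_pos_nonneg)
      have "(a n * L / n) powr p \<le> risk_rate \<rho> \<kappa> n (a n)"
        by (simp add: risk_rate_def p_def L_def)
      also have "\<dots> \<le> risk_rate \<rho> \<kappa> n (b n)"
        using arg_min_risk_rate_le elim bn by auto
      also have "\<dots> = n powr (- 2 * \<rho> * b n) + (b n * L / n) powr p"
        by (simp add: risk_rate_def p_def L_def)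
      also have "n powr (- 2 * \<rho> * b n) = n powr (- p) / L"
      proof -
        have "- 2 * \<rho> * b n * L = - p * L - ln L"
          using p pos L by (simp add: b_def L_def[symmetric] field_simps)
        then show ?thesis
          using L n by (simp add: powr_def L_def[symmetric] exp_diff mult.commute)
      qed
      also have "\<dots> + (b n * L / n) powr p \<le> (L / n) powr p * (1 / L) + (L / n) powr p * b n powr p"
      proof -
        have "n powr (- p) \<le> (L / n) powr p"
          using L n p by (simp add: powr_divide powr_minus field_simps ge_one_powr_ge_zero)
        moreover have "(b n * L / n) powr p = (L / n) powr p * b n powr p"
          using L n bn by (simp add: powr_mult powr_divide)
        ultimately show ?thesis
          using L by (simp add: divide_right_mono)
      qed
      also have "\<dots> = (L / n) powr p * (b n powr p + 1 / L)"
        by (simp add: algebra_simps)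
      finally have "(L / n) powr p * a n powr p \<le> (L / n) powr p * (b n powr p + 1 / L)"
        using L n arg_min_risk_rate_nonneg[OF elim(3)] by (simp add: powr_mult powr_divide mult_ac)
      then have "a n powr p \<le> b n powr p + 1 / L"
        using L n by (simp add: mult_le_cancel_left)
      also have "\<dots> \<le> h n powr p"
        using elim by (simp add: L_def)
      finally show ?case
        using p hn powr_less_mono2[of p "h n" "a n"] by (meson less_imp_le not_less)
    qed
  qed
  obtain K where K: "0 < K" and
    bigo: "\<forall>\<^sub>F n in sequentially. norm (risk_rate \<rho> \<kappa> n a0) \<le> K * norm ((ln (real n) / real n) powr p)"
    using risk_rate_balance_bigo[OF pos] landau_o.bigE by (metis a0_def p_def)
  have lower: "\<forall>\<^sub>F n in sequentially. a0 - (ln K + p * ln (ln (real n))) / (2 * \<rho> * ln (real n)) \<le> a n"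
  proof -
    have "\<forall>\<^sub>F n in sequentially. 1 < ln (real n)" by real_asymp
    moreover have "\<forall>\<^sub>F n in sequentially. 1 < real n" by real_asymp
    ultimately show ?thesis
      using a bigo
    proof eventually_elim
      case (elim n)
      define L where "L = ln (real n)"
      have L: "1 < L" and n: "0 < real n" using elim by (auto simp: L_def)
      have "real n powr (- 2 * \<rho> * a n) \<le> risk_rate \<rho> \<kappa> n (a n)"
        by (rule type_I_rate_le_risk_rate)
      also have "\<dots> \<le> risk_rate \<rho> \<kappa> n a0"
        using arg_min_risk_rate_le elim p by auto
      also have "\<dots> \<le> K * (L / n) powr p"
        using elim by (simp add: L_def)
      finally have "ln (real n powr (- 2 * \<rho> * a n)) \<le> ln (K * (L / n) powr p)"
        using n L K by (subst ln_le_cancel_iff) auto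
      then have "- 2 * \<rho> * a n * L \<le> ln K + p * (ln L - L)"
        using n L K by (simp add: ln_mult ln_powr ln_div L_def[symmetric])
      then show ?case
        using pos p L by (simp add: L_def[symmetric] field_simps)
    qed
  qed
  have u: "(\<lambda>n. h n - a0) \<in> O(\<lambda>n. ln (ln (real n)) / ln (real n))"
    unfolding h_def using pos by real_asymp
  have l: "(\<lambda>n. (ln K + p * ln (ln (real n))) / (2 * \<rho> * ln (real n))) \<in> O(\<lambda>n. ln (ln (real n)) / ln (real n))"
    using p pos by real_asymp
  define v where "v n = (ln K + p * ln (ln (real n))) / (2 * \<rho> * ln (real n))" for n :: nat
  have "\<forall>\<^sub>F n in sequentially. norm (a n - a0) \<le> 1 * norm (\<bar>h n - a0\<bar> + \<bar>v n\<bar>)"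
    using upper lower unfolding v_def[symmetric]
  proof eventually_elim
    case (elim n)
    then have "\<bar>a n - a0\<bar> \<le> \<bar>h n - a0\<bar> + \<bar>v n\<bar>"
      by linarith
    then show ?case
      by simp
  qed
  then have "(\<lambda>n. a n - a0) \<in> O(\<lambda>n. \<bar>h n - a0\<bar> + \<bar>v n\<bar>)"
    by (rule bigoI)
  also have "(\<lambda>n. \<bar>h n - a0\<bar> + \<bar>v n\<bar>) \<in> O(\<lambda>n. ln (ln (real n)) / ln (real n))"
    using u l unfolding v_def[symmetric] by (intro sum_in_bigo) simp_all
  finally show ?thesis
    by (simp add: a0_def)
qed

lemma arg_min_risk_rate_tendsto:
  assumes "0 < \<rho>" "0 < \<kappa>"
    and "\<forall>\<^sub>F n in sequentially. is_arg_min (risk_rate \<rho> \<kappa> n) (\<lambda>a. a \<ge> 0) (a n)"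
  shows "a \<longlonglongrightarrow> \<kappa> / (4 * \<rho>)"
proof -
  note arg_min_risk_rate_asymp[OF assms]
  also have "(\<lambda>n. ln (ln (real n)) / ln (real n)) \<in> o(\<lambda>_. 1)"
    by real_asymp
  finally have "(\<lambda>n. a n - \<kappa> / (4 * \<rho>)) \<longlonglongrightarrow> 0"
    using smalloD_tendsto by fastforce
  then show ?thesis
    by (rule LIM_zero_cancel)
qed

lemma abs_sqrt_diff_le: "\<bar>sqrt x - sqrt y\<bar> \<le> sqrt \<bar>x - y\<bar>" if "0 \<le> x" "0 \<le> y"
proof (cases "x \<le> y")
  case True
  have "sqrt (x + (y - x)) \<le> sqrt x + sqrt (y - x)"
    using True that by (intro sqrt_add_le_add_sqrt) auto
  then show ?thesis
    using True that by (simp add: abs_real_def)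
next
  case False
  have "sqrt (y + (x - y)) \<le> sqrt y + sqrt (x - y)"
    using False that by (intro sqrt_add_le_add_sqrt) auto
  then show ?thesis
    using False that by (simp add: abs_real_def)
qed

text \<open>
  Since \<open>\<bar>sqrt x - sqrt y\<bar> \<le> sqrt \<bar>x - y\<bar>\<close>, an error \<open>O(ln (ln n) / ln n)\<close> in \<open>a\<close> becomes
  \<open>O(sqrt (ln (ln n)))\<close> in \<open>sqrt (a * ln n)\<close>.
\<close>

lemma arg_min_threshold_asymp:
  assumes pos: "0 < \<rho>" "0 < \<kappa>"
    and a: "\<forall>\<^sub>F n in sequentially. is_arg_min (risk_rate \<rho> \<kappa> n) (\<lambda>a. a \<ge> 0) (a n)"
  shows "(\<lambda>n. log_threshold (a n) n - sqrt (\<kappa> * ln (real n) / (4 * \<rho>))) \<in> O(\<lambda>n. sqrt (ln (ln (real n))))"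
proof -
  obtain K where K: "0 < K" and
    bigo: "\<forall>\<^sub>F n in sequentially. norm (a n - \<kappa> / (4 * \<rho>)) \<le> K * norm (ln (ln (real n)) / ln (real n))"
    using arg_min_risk_rate_asymp[OF assms] by (rule landau_o.bigE)
  have "\<forall>\<^sub>F n in sequentially. 1 < ln (real n)" by real_asymp
  with bigo a have "\<forall>\<^sub>F n in sequentially. norm (log_threshold (a n) n - sqrt (\<kappa> * ln (real n) / (4 * \<rho>)))
      \<le> sqrt K * norm (sqrt (ln (ln (real n))))"
  proof eventually_elim
    case (elim n)
    define L where "L = ln (real n)"
    have L: "1 < L" using elim by (simp add: L_def)
    have "norm (log_threshold (a n) n - sqrt (\<kappa> * L / (4 * \<rho>))) \<le> sqrt \<bar>a n * L - \<kappa> * L / (4 * \<rho>)\<bar>"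
      unfolding log_threshold_def L_def[symmetric] real_norm_def
      using L pos arg_min_risk_rate_nonneg[OF elim(2)] by (intro abs_sqrt_diff_le) auto
    also have "a n * L - \<kappa> * L / (4 * \<rho>) = (a n - \<kappa> / (4 * \<rho>)) * L"
      by (simp add: left_diff_distrib)
    also have "\<bar>\<dots>\<bar> = \<bar>a n - \<kappa> / (4 * \<rho>)\<bar> * L"
      using L by (simp add: abs_mult)
    also have "\<dots> \<le> K * (ln L / L) * L"
      using elim L by (intro mult_right_mono) (auto simp: L_def[symmetric])
    also have "\<dots> = K * ln L"
      using L by simp
    finally show ?case
      using L by (simp add: real_sqrt_mult L_def)
  qed
  then show ?thesis
    by (rule bigoI)
qed

section \<open>The trade-off between the two error terms\<close>

text \<open>
  The trade-off concerns two functions of the threshold, one decreasing and one increasing, whose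
  orders in the windows determine the behaviour of their sum. Monotonicity carries the bounds to
  thresholds outside the windows.
\<close>

locale error_tradeoff =
  fixes \<alpha> \<beta> :: "nat \<Rightarrow> real \<Rightarrow> real" and \<rho> \<kappa> :: real
  assumes exponents: "0 < \<rho>" "0 < \<kappa>"
    and nonneg: "\<And>n t. 0 \<le> \<alpha> n t" "\<And>n t. 0 \<le> \<beta> n t"
    and antimono: "\<And>n s t. s \<le> t \<Longrightarrow> \<alpha> n t \<le> \<alpha> n s"
    and mono: "\<And>n s t. s \<le> t \<Longrightarrow> \<beta> n s \<le> \<beta> n t"
    and \<alpha>_order: "window_order \<alpha> (\<lambda>n t. exp (- 2 * \<rho> * t\<^sup>2))"
    and \<beta>_order: "window_order \<beta> (\<lambda>n t. (t / sqrt (real n)) powr \<kappa>)"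
begin

definition risk :: "nat \<Rightarrow> real \<Rightarrow> real" where
  "risk n t = \<alpha> n t + \<beta> n t"

abbreviation optimal_rate :: "nat \<Rightarrow> real" where
  "optimal_rate n \<equiv> (ln (real n) / real n) powr (\<kappa> / 2)"

lemma risk_nonneg: "0 \<le> risk n t"
  using nonneg by (simp add: risk_def)

lemma risk_bigtheta_risk_rate:
  assumes a: "a \<longlonglongrightarrow> a0" "0 < a0"
  shows "(\<lambda>n. risk n (log_threshold (a n) n)) \<in> \<Theta>(\<lambda>n. risk_rate \<rho> \<kappa> n (a n))"
proof -
  have *: "\<forall>\<^sub>F n in sequentially.
      exp (- 2 * \<rho> * (log_threshold (a n) n)\<^sup>2) + (log_threshold (a n) n / sqrt (real n)) powr \<kappa>
      = risk_rate \<rho> \<kappa> n (a n)"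
    using eventually_gt_at_top[of 0] order_tendstoD(1)[OF a]
    by eventually_elim (subst exp_log_threshold powr_log_threshold; simp add: risk_rate_def)+
  have "window_order risk (\<lambda>n t. exp (- 2 * \<rho> * t\<^sup>2) + (t / sqrt (real n)) powr \<kappa>)"
    unfolding risk_def[abs_def] by (intro window_order_add \<alpha>_order \<beta>_order) auto
  from bigtheta_log_threshold[OF this _ a] show ?thesis
    unfolding landau_theta.cong[OF *] by (simp add: add_nonneg_nonneg)
qed

lemma optimal_rate_bigo_risk_rate:
  assumes a: "a \<longlonglongrightarrow> a0" "0 < a0"
  shows "optimal_rate \<in> O(\<lambda>n. risk_rate \<rho> \<kappa> n (a n))"
proof (rule bigoI)
  have "\<forall>\<^sub>F n in sequentially. a0 / 2 < a n"
    using order_tendstoD(1)[OF a(1), of "a0 / 2"] a(2) by simp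
  moreover have "\<forall>\<^sub>F n in sequentially. 0 < ln (real n)"
    by real_asymp
  ultimately show "\<forall>\<^sub>F n in sequentially. norm (optimal_rate n)
      \<le> (a0 / 2) powr (- \<kappa> / 2) * norm (risk_rate \<rho> \<kappa> n (a n))"
  proof eventually_elim
    case (elim n)
    have n: "0 < real n"
      using elim by (cases "n = 0") auto
    have "(a0 / 2) powr (\<kappa> / 2) * optimal_rate n = (a0 / 2 * ln (real n) / real n) powr (\<kappa> / 2)"
      using elim a n by (simp add: powr_mult[symmetric])
    also have "\<dots> \<le> (a n * ln (real n) / real n) powr (\<kappa> / 2)"
      using elim a n exponents by (intro powr_mono2 divide_right_mono mult_right_mono) auto
    also have "\<dots> \<le> risk_rate \<rho> \<kappa> n (a n)"
      by (rule type_II_rate_le_risk_rate)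
    finally have le: "(a0 / 2) powr (\<kappa> / 2) * optimal_rate n \<le> risk_rate \<rho> \<kappa> n (a n)" .
    have "optimal_rate n = (a0 / 2) powr (- \<kappa> / 2) * ((a0 / 2) powr (\<kappa> / 2) * optimal_rate n)"
      using a by (simp add: powr_add[symmetric] mult.assoc[symmetric])
    also have "\<dots> \<le> (a0 / 2) powr (- \<kappa> / 2) * risk_rate \<rho> \<kappa> n (a n)"
      using le by (intro mult_left_mono) auto
    finally show ?case
      by (simp add: risk_rate_def)
  qed
qed

text \<open>
  Any choice of \<open>a\<close> with a positive limit that does no worse than \<open>\<kappa> / (4 * \<rho>)\<close> attains the
  optimal rate, because the second term of the rate alone already has the optimal order. This covers
  both \<open>\<kappa> / (4 * \<rho>)\<close> and the minimisers.
\<close>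

lemma risk_optimal:
  assumes a: "a \<longlonglongrightarrow> a0" "0 < a0"
    and le: "\<forall>\<^sub>F n in sequentially. risk_rate \<rho> \<kappa> n (a n) \<le> risk_rate \<rho> \<kappa> n (\<kappa> / (4 * \<rho>))"
  shows "(\<lambda>n. risk n (log_threshold (a n) n)) \<in> \<Theta>(optimal_rate)"
proof -
  have "(\<lambda>n. risk_rate \<rho> \<kappa> n (a n)) \<in> O(\<lambda>n. risk_rate \<rho> \<kappa> n (\<kappa> / (4 * \<rho>)))"
    by (rule bigoI[where c = 1]) (use le in \<open>auto elim!: eventually_mono simp: risk_rate_def\<close>)
  also note risk_rate_balance_bigo[OF exponents]
  finally have "(\<lambda>n. risk_rate \<rho> \<kappa> n (a n)) \<in> \<Theta>(optimal_rate)"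
    using optimal_rate_bigo_risk_rate[OF a] by (simp add: bigtheta_def bigomega_iff_bigo)
  with risk_bigtheta_risk_rate[OF a] show ?thesis
    by (rule landau_theta.trans)
qed

lemma risk_balance: "(\<lambda>n. risk n (log_threshold (\<kappa> / (4 * \<rho>)) n)) \<in> \<Theta>(optimal_rate)"
  by (rule risk_optimal[OF tendsto_const]) (use exponents in auto)

text \<open>
  The lower bound must hold for every real threshold. Compare with a pivot
  \<open>s = log_threshold a n\<close> whose factor \<open>a\<close> is half the balancing one. A threshold below \<open>s\<close> has first error
  term at least that at \<open>s\<close>, of order \<open>n powr (- \<kappa> / 4)\<close>, which is much larger than
  the optimal rate; a threshold above \<open>s\<close> has second error term at least that at \<open>s\<close>, which is of
  the optimal order.
\<close>

lemma INF_risk: "(\<lambda>n. INF t. risk n t) \<in> \<Theta>(optimal_rate)"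
proof -
  have bdd: "bdd_below (range (risk n))" for n
    using risk_nonneg by (intro bdd_belowI[of _ 0]) auto
  have INF_nonneg: "0 \<le> (INF t. risk n t)" for n
    by (intro cINF_greatest risk_nonneg) auto
  have "(\<lambda>n. INF t. risk n t) \<in> O(\<lambda>n. risk n (log_threshold (\<kappa> / (4 * \<rho>)) n))"
    using INF_nonneg risk_nonneg bdd
    by (intro bigoI[where c = 1] always_eventually allI) (simp add: cINF_lower)
  also note bigthetaD1[OF risk_balance]
  finally have upper: "(\<lambda>n. INF t. risk n t) \<in> O(optimal_rate)" .

  define a where "a = \<kappa> / (8 * \<rho>)"
  have a: "0 < a" "2 * \<rho> * a = \<kappa> / 4"
    using exponents by (auto simp: a_def)
  let ?s = "log_threshold a"
  have "optimal_rate \<in> O(\<lambda>n. real n powr (- 2 * \<rho> * a))"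
    using exponents a by simp real_asymp
  also have "(\<lambda>n. real n powr (- 2 * \<rho> * a)) \<in> O(\<lambda>n. \<alpha> n (?s n))"
    using bigthetaD2[OF bigtheta_exp_log_threshold[OF \<alpha>_order tendsto_const a(1)]]
    by (simp add: bigomega_iff_bigo)
  finally obtain c1 where c1: "0 < c1" "\<forall>\<^sub>F n in sequentially. norm (optimal_rate n) \<le> c1 * norm (\<alpha> n (?s n))"
    by (rule landau_o.bigE)
  have "optimal_rate \<in> O(\<lambda>n. (a * ln (real n) / real n) powr (\<kappa> / 2))"
    using exponents a(1) by real_asymp
  also have "(\<lambda>n. (a * ln (real n) / real n) powr (\<kappa> / 2)) \<in> O(\<lambda>n. \<beta> n (?s n))"
    using bigthetaD2[OF bigtheta_powr_log_threshold[OF \<beta>_order tendsto_const a(1)]]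
    by (simp add: bigomega_iff_bigo)
  finally obtain c2 where c2: "0 < c2" "\<forall>\<^sub>F n in sequentially. norm (optimal_rate n) \<le> c2 * norm (\<beta> n (?s n))"
    by (rule landau_o.bigE)
  have "optimal_rate \<in> O(\<lambda>n. INF t. risk n t)"
  proof (rule bigoI)
    show "\<forall>\<^sub>F n in sequentially. norm (optimal_rate n) \<le> max c1 c2 * norm (INF t. risk n t)"
      using c1(2) c2(2)
    proof eventually_elim
      case (elim n)
      have "optimal_rate n / max c1 c2 \<le> risk n t" for t
      proof (cases "t \<le> ?s n")
        case True
        have "optimal_rate n \<le> c1 * \<alpha> n (?s n)"
          using elim(1) nonneg(1)[of n "?s n"] by simp
        also have "\<dots> \<le> max c1 c2 * risk n t"
          using c1 antimono[OF True, of n] nonneg by (intro mult_mono) (auto simp: risk_def add_increasing2)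
        finally show ?thesis
          using c1 by (simp add: divide_le_eq less_max_iff_disj mult.commute)
      next
        case False
        have "optimal_rate n \<le> c2 * \<beta> n (?s n)"
          using elim(2) nonneg(2)[of n "?s n"] by simp
        also have "\<dots> \<le> max c1 c2 * risk n t"
          using c2 mono[of "?s n" t n] False nonneg by (intro mult_mono) (auto simp: risk_def add_increasing)
        finally show ?thesis
          using c1 by (simp add: divide_le_eq less_max_iff_disj mult.commute)
      qed
      then have "optimal_rate n / max c1 c2 \<le> (INF t. risk n t)"
        by (intro cINF_greatest) auto
      then show ?case
        using c1 INF_nonneg[of n] by (simp add: divide_le_eq less_max_iff_disj mult.commute)
    qed
  qed
  with upper show ?thesis
    by (simp add: bigtheta_def bigomega_iff_bigo)
qed

text \<open>
  At a fixed threshold in the window the first error term is bounded away from 0, and it only grows as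
  the threshold decreases.
\<close>

lemma risk_bounded_below: "\<exists>b>0. \<forall>\<^sub>F n in sequentially. \<forall>t\<le>\<tau>. b \<le> risk n t"
proof -
  obtain c C t0 where c: "0 < c" and e: "\<forall>\<^sub>F n in sequentially. \<forall>t\<in>{t0..1 * sqrt (ln (real n))}.
      c * exp (- 2 * \<rho> * t\<^sup>2) \<le> \<alpha> n t \<and> \<alpha> n t \<le> C * exp (- 2 * \<rho> * t\<^sup>2)"
    using window_orderE[OF \<alpha>_order zero_less_one] by blast
  define s where "s = max t0 \<tau>"
  have "\<forall>\<^sub>F n in sequentially. s \<le> sqrt (ln (real n))"
    by real_asymp
  with e have "\<forall>\<^sub>F n in sequentially. \<forall>t\<le>\<tau>. c * exp (- 2 * \<rho> * s\<^sup>2) \<le> risk n t"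
  proof eventually_elim
    case (elim n)
    show ?case
    proof (intro allI impI)
      fix t assume "t \<le> \<tau>"
      then have "\<alpha> n s \<le> \<alpha> n t"
        by (intro antimono) (simp add: s_def)
      moreover have "c * exp (- 2 * \<rho> * s\<^sup>2) \<le> \<alpha> n s"
        using elim by (auto simp: s_def)
      ultimately show "c * exp (- 2 * \<rho> * s\<^sup>2) \<le> risk n t"
        using nonneg(2)[of n t] by (simp add: risk_def)
    qed
  qed
  then show ?thesis
    using c by (intro exI[of _ "c * exp (- 2 * \<rho> * s\<^sup>2)"]) simp
qed

text \<open>
  The threshold \<open>sqrt (c * n * ln n)\<close> eventually leaves every window upwards. Monotonicity bounds the
  first error term by its value at \<open>log_threshold a n\<close>, where \<open>a\<close> is chosen such that this value has order
  \<open>n powr (- \<kappa> / 2 - 1)\<close>, and the second error term from below by its value at \<open>log_threshold 1 n\<close>.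
\<close>

lemma large_threshold_smallo:
  assumes c: "0 < c"
  shows "(\<lambda>n. \<alpha> n (log_threshold (c * real n) n)) \<in> o(\<lambda>n. \<beta> n (log_threshold (c * real n) n))"
proof -
  define a where "a = (\<kappa> / 2 + 1) / (2 * \<rho>)"
  have a: "0 < a" "2 * \<rho> * a = \<kappa> / 2 + 1"
    using exponents by (auto simp: a_def)
  have le: "\<forall>\<^sub>F n in sequentially. log_threshold b n \<le> log_threshold (c * real n) n" for b
  proof -
    have "\<forall>\<^sub>F n in sequentially. b \<le> c * real n" "\<forall>\<^sub>F n in sequentially. 0 < ln (real n)"
      using c by real_asymp+
    then show ?thesis
      by eventually_elim (simp add: log_threshold_def mult_right_mono)
  qed
  have "(\<lambda>n. \<alpha> n (log_threshold (c * real n) n)) \<in> O(\<lambda>n. \<alpha> n (log_threshold a n))"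
    by (rule bigoI[where c = 1], use le[of a] in eventually_elim) (use nonneg antimono in simp)
  also have "(\<lambda>n. \<alpha> n (log_threshold a n)) \<in> O(\<lambda>n. real n powr (- 2 * \<rho> * a))"
    using bigthetaD1[OF bigtheta_exp_log_threshold[OF \<alpha>_order tendsto_const a(1)]] .
  also have "(\<lambda>n. real n powr (- 2 * \<rho> * a)) \<in> o(\<lambda>n. (1 * ln (real n) / real n) powr (\<kappa> / 2))"
    using exponents a by simp real_asymp
  also have "(\<lambda>n. (1 * ln (real n) / real n) powr (\<kappa> / 2)) \<in> O(\<lambda>n. \<beta> n (log_threshold 1 n))"
    using bigthetaD2[OF bigtheta_powr_log_threshold[OF \<beta>_order tendsto_const zero_less_one]]
    by (simp add: bigomega_iff_bigo)
  also have "(\<lambda>n. \<beta> n (log_threshold 1 n)) \<in> O(\<lambda>n. \<beta> n (log_threshold (c * real n) n))"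
    by (rule bigoI[where c = 1], use le[of 1] in eventually_elim) (use nonneg mono in simp)
  finally show ?thesis .
qed

end

section \<open>The Bayes risk of threshold tests\<close>

theorem theorem2p6:
  fixes M :: "'a measure"
    and \<F>0 \<F>1 :: "'a measure set"
    and d :: "'a measure \<Rightarrow> 'a measure \<Rightarrow> real"
    and T :: "nat \<Rightarrow> (nat \<Rightarrow> 'a) \<Rightarrow> real"
    and \<Pi>0 \<Pi>1 :: "'a measure measure"
    and \<pi>0 \<pi>1 L0 L1 \<rho> \<kappa> :: real
  assumes classes: "\<F>0 \<subseteq> space (prob_algebra M)" "\<F>1 \<subseteq> space (prob_algebra M)" "\<F>0 \<inter> \<F>1 = {}"
    and weights: "\<pi>0 > 0" "\<pi>1 > 0" "\<pi>0 + \<pi>1 = 1"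
    and losses: "L0 > 0" "L1 > 0"
    and priors: "prior_on M \<F>0 \<Pi>0" "prior_on M \<F>1 \<Pi>1"
    and statistic: "\<And>n. T n \<in> borel_measurable (Pi\<^sub>M {..<n} (\<lambda>_. M))"
    and distance: "Metric_space (\<F>0 \<union> \<F>1) d" "set_distance d \<F>0 \<in> borel_measurable \<Pi>1"
    and exponents: "\<rho> > 0" "\<kappa> > 0"
    and null_tail: "subgaussian_null_tail T \<F>0 \<rho>"
    and detectability: "local_detectability T d \<F>0 \<F>1"
    and prior_mass: "polynomial_prior_mass d \<F>0 \<Pi>1 \<kappa>"
    and rate: "detection_rate T d \<F>0 \<F>1 \<kappa>"
    and undetected: "undetected_below_scale T d \<F>0 \<F>1"
  shows
    "(\<forall>a>0. (\<lambda>n. bayes_risk \<pi>0 L0 \<Pi>0 \<pi>1 L1 \<Pi>1 n (threshold_test T n (log_threshold a n)))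
        \<in> \<Theta>(\<lambda>n. risk_rate \<rho> \<kappa> n a)) \<and>
    (\<forall>\<^sub>F n in sequentially. \<exists>a. is_arg_min (risk_rate \<rho> \<kappa> n) (\<lambda>a. a \<ge> 0) a) \<and>
    (\<forall>a. (\<forall>\<^sub>F n in sequentially. is_arg_min (risk_rate \<rho> \<kappa> n) (\<lambda>a. a \<ge> 0) (a n)) \<longrightarrow>
      a \<longlonglongrightarrow> \<kappa> / (4 * \<rho>) \<and>
      (\<lambda>n. log_threshold (a n) n - sqrt (\<kappa> * ln (real n) / (4 * \<rho>)))
        \<in> O(\<lambda>n. sqrt (ln (ln (real n)))) \<and>
      (\<forall>F0\<in>\<F>0. (\<lambda>n. ln (reject_prob T n F0 (log_threshold (a n) n)) / ln (real n))
        \<longlonglongrightarrow> - (\<kappa> / 2)) \<and>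
      (\<lambda>n. bayes_risk \<pi>0 L0 \<Pi>0 \<pi>1 L1 \<Pi>1 n (threshold_test T n (log_threshold (a n) n)))
        \<in> \<Theta>(\<lambda>n. (ln (real n) / real n) powr (\<kappa> / 2))) \<and>
    (\<forall>F0\<in>\<F>0. (\<lambda>n. reject_prob T n F0 (log_threshold (\<kappa> / (4 * \<rho>)) n))
        \<in> \<Theta>(\<lambda>n. real n powr (- \<kappa> / 2))) \<and>
    (\<lambda>n. bayes_risk \<pi>0 L0 \<Pi>0 \<pi>1 L1 \<Pi>1 n (threshold_test T n (log_threshold (\<kappa> / (4 * \<rho>)) n)))
        \<in> \<Theta>(\<lambda>n. (ln (real n) / real n) powr (\<kappa> / 2)) \<and>
    (\<lambda>n. INF t. bayes_risk \<pi>0 L0 \<Pi>0 \<pi>1 L1 \<Pi>1 n (threshold_test T n t))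
        \<in> \<Theta>(\<lambda>n. (ln (real n) / real n) powr (\<kappa> / 2)) \<and>
    (\<exists>b>0. \<forall>\<^sub>F n in sequentially.
      b \<le> bayes_risk \<pi>0 L0 \<Pi>0 \<pi>1 L1 \<Pi>1 n (threshold_test T n (log_threshold 0 n))) \<and>
    (\<forall>F0\<in>\<F>0. \<forall>\<alpha> t. 0 < \<alpha> \<and> \<alpha> < 1 \<and> (\<forall>\<^sub>F n in sequentially. reject_prob T n F0 (t n) = \<alpha>) \<longrightarrow>
      (\<exists>b>0. \<forall>\<^sub>F n in sequentially.
        b \<le> bayes_risk \<pi>0 L0 \<Pi>0 \<pi>1 L1 \<Pi>1 n (threshold_test T n (t n)))) \<and>
    (\<forall>c>0. (\<lambda>n. type_I_term \<pi>0 L0 \<Pi>0 n (threshold_test T n (log_threshold (c * real n) n)))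
        \<in> o(\<lambda>n. type_II_term \<pi>1 L1 \<Pi>1 n (threshold_test T n (log_threshold (c * real n) n))))"
proof -
  interpret null: randomized_sampling M \<F>0 \<Pi>0 T
    using priors statistic by unfold_locales
  interpret alt: randomized_sampling M \<F>1 \<Pi>1 T
    using priors statistic by unfold_locales
  let ?\<alpha> = "\<lambda>n t. type_I_term \<pi>0 L0 \<Pi>0 n (threshold_test T n t)"
  let ?\<beta> = "\<lambda>n t. type_II_term \<pi>1 L1 \<Pi>1 n (threshold_test T n t)"
  have order: "window_order ?\<alpha> (\<lambda>n t. exp (- 2 * \<rho> * t\<^sup>2))"
      "window_order ?\<beta> (\<lambda>n t. (t / sqrt (real n)) powr \<kappa>)"
    by (rule null.window_order_type_I_term[OF null_tail weights(1) losses(1)]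
        alt.window_order_type_II_term[OF distance(2) prior_mass rate undetected exponents(2)
          weights(2) losses(2)])+
  interpret error_tradeoff ?\<alpha> ?\<beta> \<rho> \<kappa>
    using weights losses exponents order
    by unfold_locales
      (auto intro: null.type_I_term_nonneg alt.type_II_term_nonneg null.type_I_term_antimono
        alt.type_II_term_mono)
  have risk: "bayes_risk \<pi>0 L0 \<Pi>0 \<pi>1 L1 \<Pi>1 n (threshold_test T n t) = risk n t" for n t
    by (simp add: bayes_risk_def risk_def)
  note reject_order = window_order_reject_prob[OF null_tail]
  show ?thesis
    unfolding risk
  proof (intro conjI allI ballI impI)
    fix a :: real assume "0 < a"
    then show "(\<lambda>n. risk n (log_threshold a n)) \<in> \<Theta>(\<lambda>n. risk_rate \<rho> \<kappa> n a)"
      by (intro risk_bigtheta_risk_rate[OF tendsto_const])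
  next
    show "\<forall>\<^sub>F n in sequentially. \<exists>a. is_arg_min (risk_rate \<rho> \<kappa> n) (\<lambda>a. a \<ge> 0) a"
      using eventually_ge_at_top[of 2] by eventually_elim (intro risk_rate_attains_min exponents)
  next
    fix a assume a: "\<forall>\<^sub>F n in sequentially. is_arg_min (risk_rate \<rho> \<kappa> n) (\<lambda>a. a \<ge> 0) (a n)"
    show lim: "a \<longlonglongrightarrow> \<kappa> / (4 * \<rho>)"
      by (rule arg_min_risk_rate_tendsto[OF exponents a])
    show "(\<lambda>n. log_threshold (a n) n - sqrt (\<kappa> * ln (real n) / (4 * \<rho>))) \<in> O(\<lambda>n. sqrt (ln (ln (real n))))"
      by (rule arg_min_threshold_asymp[OF exponents a])
    have pos: "0 < \<kappa> / (4 * \<rho>)"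
      using exponents by simp
    show "(\<lambda>n. ln (reject_prob T n F0 (log_threshold (a n) n)) / ln (real n)) \<longlonglongrightarrow> - (\<kappa> / 2)"
      if "F0 \<in> \<F>0" for F0
    proof (rule bigtheta_powr_ln_ratio[OF bigtheta_exp_log_threshold[OF reject_order[OF that] lim pos]])
      have "(\<lambda>n. - 2 * \<rho> * a n) \<longlonglongrightarrow> - 2 * \<rho> * (\<kappa> / (4 * \<rho>))"
        by (intro tendsto_intros lim)
      then show "(\<lambda>n. - 2 * \<rho> * a n) \<longlonglongrightarrow> - (\<kappa> / 2)"
        using exponents by simp
    qed (rule null.reject_prob_nonneg)
    show "(\<lambda>n. risk n (log_threshold (a n) n)) \<in> \<Theta>(optimal_rate)"
      by (rule risk_optimal[OF lim pos])
        (use a pos in \<open>auto elim!: eventually_mono intro: arg_min_risk_rate_le\<close>)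
  next
    fix F0 assume "F0 \<in> \<F>0"
    from bigtheta_exp_log_threshold[OF reject_order[OF this] tendsto_const, of "\<kappa> / (4 * \<rho>)"]
    show "(\<lambda>n. reject_prob T n F0 (log_threshold (\<kappa> / (4 * \<rho>)) n)) \<in> \<Theta>(\<lambda>n. real n powr (- \<kappa> / 2))"
      using exponents by simp
  next
    show "\<exists>b>0. \<forall>\<^sub>F n in sequentially. b \<le> risk n (log_threshold 0 n)"
      using risk_bounded_below[of 0] by (auto simp: log_threshold_def elim!: eventually_mono)
  next
    fix F0 \<alpha> t
    assume F0: "F0 \<in> \<F>0" and "0 < \<alpha> \<and> \<alpha> < 1 \<and> (\<forall>\<^sub>F n in sequentially. reject_prob T n F0 (t n) = \<alpha>)"
    then have \<alpha>: "0 < \<alpha>" and level: "\<forall>\<^sub>F n in sequentially. reject_prob T n F0 (t n) = \<alpha>"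
      by auto
    \<comment> \<open>A fixed level keeps the thresholds bounded, because the null tail at a large fixed
      \<open>s\<close> is below the level.\<close>
    obtain c C t0 where C: "0 < C" and
      e: "\<forall>\<^sub>F n in sequentially. \<forall>t\<in>{t0..1 * sqrt (ln (real n))}.
        c * exp (- 2 * \<rho> * t\<^sup>2) \<le> reject_prob T n F0 t \<and> reject_prob T n F0 t \<le> C * exp (- 2 * \<rho> * t\<^sup>2)"
      using window_orderE[OF reject_order[OF F0] zero_less_one] by blast
    have "\<forall>\<^sub>F s in at_top. C * exp (- 2 * \<rho> * s\<^sup>2) < \<alpha>"
      using exponents \<alpha> C by real_asymp
    with eventually_ge_at_top[of t0] have "\<forall>\<^sub>F s in at_top. t0 \<le> s \<and> C * exp (- 2 * \<rho> * s\<^sup>2) < \<alpha>"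
      by eventually_elim simp
    then obtain s where s: "t0 \<le> s" "C * exp (- 2 * \<rho> * s\<^sup>2) < \<alpha>"
      by (auto dest: eventually_happens)
    obtain b where b: "0 < b" "\<forall>\<^sub>F n in sequentially. \<forall>t\<le>s. b \<le> risk n t"
      using risk_bounded_below by blast
    have "\<forall>\<^sub>F n in sequentially. s \<le> sqrt (ln (real n))"
      by real_asymp
    with e level b(2) have "\<forall>\<^sub>F n in sequentially. b \<le> risk n (t n)"
    proof eventually_elim
      case (elim n)
      have "reject_prob T n F0 s < \<alpha>"
        using elim s by force
      then have "t n \<le> s"
        using null.reject_prob_antimono[OF F0, of s "t n" n] elim(2) by linarith
      then show ?case
        using elim by simp
    qed
    with b(1) show "\<exists>b>0. \<forall>\<^sub>F n in sequentially. b \<le> risk n (t n)"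
      by blast
  qed (rule risk_balance INF_risk large_threshold_smallo; assumption)+
qed

end
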